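(* Let $E$ and $F$ be Banach lattices. Each positive uaw-Dunford–Pettis operator $T:E\to F$ is weak Dunford–Pettis if one of the following holds: (1) the lattice operations in $E$ are weakly sequentially continuous; (2) $F$ is discrete with an order continuous norm; (3) $F$ has the AM-compactness property.
   Context: All operators are continuous linear operators. A net $(x_\alpha)$ in a Banach lattice $E$ is uaw-convergent to $x$ (written $x_\alpha\xrightarrow{uaw}x$) if $|x_\alpha-x|\wedge u\to 0$ weakly for every $u\in E_+$. An operator $T$ from a Banach lattice $E$ into a Banach space $X$ is uaw-Dunford–Pettis if for every norm bounded sequence $(x_n)$ in $E$ with $x_n\xrightarrow{uaw}0$ one has $\|Tx_n\|\to 0$. An operator $T:X\to Y$ between Banach spaces is weak Dunford–Pettis if $f_n(Tx_n)\to 0$ for every weakly null sequence $(x_n)$ in $X$ and every weakly null sequence $(f_n)$ in $Y'$. A Banach lattice has weakly sequentially continuous lattice operations if $x_n\to 0$ weakly implies $|x_n|\to 0$ weakly. A Banach lattice $F$ has the AM-compactness property if every weakly compact operator from $F$ into an arbitrary Banach space is AM-compact, i.e. maps order bounded subsets of $F$ to relatively norm compact sets. *)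

theory Defs
  imports "HOL-Analysis.Analysis" "HOL-Probability.Discrete_Topology"
begin

instance bcontfun :: (metric_space, banach) banach ..

definition lat_abs :: "'a::{lattice, uminus} \<Rightarrow> 'a" where
  "lat_abs x = sup x (- x)"

class banach_lattice = banach + ordered_real_vector + lattice +
  assumes lattice_norm: "sup x (- x) \<le> sup y (- y) \<Longrightarrow> norm x \<le> norm y"

definition weak_topology :: "'a::real_normed_vector topology" where
  "weak_topology = pullback_topology UNIV (\<lambda>x (f::'a \<Rightarrow>\<^sub>L real). blinfun_apply f x)
      (product_topology (\<lambda>_. euclideanreal) UNIV)"

definition weakly_tendsto :: "(nat \<Rightarrow> 'a::real_normed_vector) \<Rightarrow> 'a \<Rightarrow> bool" where
  "weakly_tendsto x l \<longleftrightarrow> (\<forall>f :: 'a \<Rightarrow>\<^sub>L real. (\<lambda>n. blinfun_apply f (x n)) \<longlonglongrightarrow> blinfun_apply f l)"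

definition uaw_tendsto :: "(nat \<Rightarrow> 'a::banach_lattice) \<Rightarrow> 'a \<Rightarrow> bool" where
  "uaw_tendsto x l \<longleftrightarrow> (\<forall>u. 0 \<le> u \<longrightarrow> weakly_tendsto (\<lambda>n. inf (lat_abs (x n - l)) u) 0)"

definition positive_op :: "('a::banach_lattice \<Rightarrow>\<^sub>L 'b::banach_lattice) \<Rightarrow> bool" where
  "positive_op T \<longleftrightarrow> (\<forall>x. 0 \<le> x \<longrightarrow> 0 \<le> blinfun_apply T x)"

definition uaw_dunford_pettis :: "('a::banach_lattice \<Rightarrow>\<^sub>L 'b::real_normed_vector) \<Rightarrow> bool" where
  "uaw_dunford_pettis T \<longleftrightarrow>
     (\<forall>x :: nat \<Rightarrow> 'a. bounded (range x) \<longrightarrow> uaw_tendsto x 0 \<longrightarrow> (\<lambda>n. norm (blinfun_apply T (x n))) \<longlonglongrightarrow> 0)"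

definition weak_dunford_pettis :: "('a::real_normed_vector \<Rightarrow>\<^sub>L 'b::real_normed_vector) \<Rightarrow> bool" where
  "weak_dunford_pettis T \<longleftrightarrow>
     (\<forall>(x :: nat \<Rightarrow> 'a) (f :: nat \<Rightarrow> ('b \<Rightarrow>\<^sub>L real)).
        weakly_tendsto x 0 \<longrightarrow> weakly_tendsto f 0 \<longrightarrow> (\<lambda>n. blinfun_apply (f n) (blinfun_apply T (x n))) \<longlonglongrightarrow> 0)"

definition weakly_seq_cont_lattice_ops :: "'a::banach_lattice itself \<Rightarrow> bool" where
  "weakly_seq_cont_lattice_ops _ \<longleftrightarrow>
     (\<forall>x :: nat \<Rightarrow> 'a. weakly_tendsto x 0 \<longrightarrow> weakly_tendsto (\<lambda>n. lat_abs (x n)) 0)"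

definition atom :: "'a::banach_lattice \<Rightarrow> bool" where
  "atom a \<longleftrightarrow> 0 < a \<and> (\<forall>x. 0 \<le> x \<and> x \<le> a \<longrightarrow> (\<exists>c::real. x = c *\<^sub>R a))"

definition discrete_lattice :: "'a::banach_lattice itself \<Rightarrow> bool" where
  "discrete_lattice _ \<longleftrightarrow> (\<forall>x::'a. 0 < x \<longrightarrow> (\<exists>a. atom a \<and> a \<le> x))"

text \<open>Order continuous norm: for every net x_alpha decreasing to 0, norm (x_alpha) tends to 0.
  A decreasing net with infimum 0 is (the range of) a nonempty downward directed set D whose
  infimum is 0; since the norm is monotone on positive elements, norm convergence to 0 of the
  net means that inf over D of the norms is 0.\<close>
definition order_continuous_norm :: "'a::banach_lattice itself \<Rightarrow> bool" where
  "order_continuous_norm _ \<longleftrightarrow>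
     (\<forall>D :: 'a set. D \<noteq> {} \<and> (\<forall>a\<in>D. \<forall>b\<in>D. \<exists>c\<in>D. c \<le> a \<and> c \<le> b)
        \<and> (\<forall>d\<in>D. 0 \<le> d) \<and> (\<forall>y. (\<forall>d\<in>D. y \<le> d) \<longrightarrow> y \<le> 0)
        \<longrightarrow> (\<forall>e>0. \<exists>d\<in>D. norm d < e))"

definition weakly_compact_op :: "('a::real_normed_vector \<Rightarrow>\<^sub>L 'b::real_normed_vector) \<Rightarrow> bool" where
  "weakly_compact_op S \<longleftrightarrow>
     (\<forall>B. bounded B \<longrightarrow> compactin weak_topology (weak_topology closure_of (blinfun_apply S ` B)))"

definition am_compact_op :: "('a::banach_lattice \<Rightarrow>\<^sub>L 'b::real_normed_vector) \<Rightarrow> bool" where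
  "am_compact_op S \<longleftrightarrow> (\<forall>A. (\<exists>a b. A \<subseteq> {a..b}) \<longrightarrow> compact (closure (blinfun_apply S ` A)))"

definition am_compactness_wrt :: "'x::banach itself \<Rightarrow> 'f::banach_lattice itself \<Rightarrow> bool" where
  "am_compactness_wrt _ _ \<longleftrightarrow>
     (\<forall>S :: 'f \<Rightarrow>\<^sub>L 'x. weakly_compact_op S \<longrightarrow> am_compact_op S)"

text \<open>Since HOL cannot quantify over all types, "arbitrary Banach space" is represented by the
  universal target l-infinity(F) = bounded functions on F (discrete topology): every operator
  T : F \<rightarrow> X factors through the closed span of its range, which embeds isometrically into
  l-infinity(F), and weak compactness / AM-compactness are invariant under this.\<close>
definition am_compactness_property :: "'f::banach_lattice itself \<Rightarrow> bool" where
  "am_compactness_property F \<longleftrightarrow> am_compactness_wrt TYPE('f discrete \<Rightarrow>\<^sub>C real) F"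

end

theory Submission
  imports Defs "HOL-Library.Lattice_Algebras"
begin

text \<open>
  Let \<open>x\<close> be weakly null in \<open>E\<close> and \<open>f\<close> weakly null in the dual of \<open>F\<close>; both are bounded. If the
  lattice operations are weakly sequentially continuous, then \<open>x\<close> is uaw-null and \<open>T (x n)\<close> tends to
  \<open>0\<close> in norm.

  Otherwise, disjoint bounded sequences are uaw-null, so \<open>T\<close> maps them to norm null sequences, and
  therefore there is for each \<open>\<epsilon> > 0\<close> some \<open>u \<ge> 0\<close> such that \<open>T\<close> is at most \<open>\<epsilon>\<close> in norm at the positive parts of
  \<open>\<bar>x n\<bar> - u\<close>. Up to \<open>\<epsilon>\<close>, only the values of \<open>f n\<close> on the order interval \<open>{0..T u}\<close> matter. There
  \<open>f\<close> tends to \<open>0\<close> uniformly: for discrete \<open>F\<close> with order continuous norm because \<open>T u\<close> is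
  approximated by elements for which this holds, and under AM-compactness because \<open>y \<mapsto> (f n y)\<^sub>n\<close> is
  a weakly compact operator into the null sequences, hence AM-compact.
\<close>

subsection \<open>The Hahn--Banach theorem and uniform boundedness\<close>

definition sublinear :: "('a::real_vector \<Rightarrow> real) \<Rightarrow> bool" where
  "sublinear p \<longleftrightarrow> (\<forall>x y. p (x + y) \<le> p x + p y) \<and> (\<forall>c\<ge>0. \<forall>x. p (c *\<^sub>R x) = c * p x)"

lemma sublinearD:
  assumes "sublinear p"
  shows sublinear_add: "p (x + y) \<le> p x + p y"
    and sublinear_scale: "c \<ge> 0 \<Longrightarrow> p (c *\<^sub>R x) = c * p x"
  using assms by (auto simp: sublinear_def)

lemma sublinear_zero: "sublinear p \<Longrightarrow> p 0 = 0"
  using sublinear_scale[of p 0 0] by simp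

lemma sublinear_minus: "sublinear p \<Longrightarrow> - p (- x) \<le> p x"
  using sublinear_add[of p x "- x"] sublinear_zero[of p] by simp

lemma sublinearI:
  assumes add: "\<And>x y. p (x + y) \<le> p x + p y"
    and scale: "\<And>c x. c > 0 \<Longrightarrow> p (c *\<^sub>R x) \<le> c * p x"
    and zero: "p 0 = 0"
  shows "sublinear p"
  unfolding sublinear_def
proof (intro conjI allI impI)
  fix c :: real and x assume "0 \<le> c"
  show "p (c *\<^sub>R x) = c * p x"
  proof (cases "c = 0")
    case False
    with \<open>0 \<le> c\<close> have c: "c > 0" by simp
    have "p x \<le> inverse c * p (c *\<^sub>R x)"
      using scale[of "inverse c" "c *\<^sub>R x"] c by simp
    then have "c * p x \<le> p (c *\<^sub>R x)"
      using c by (simp add: field_simps)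
    with scale[OF c, of x] show ?thesis by simp
  qed (simp add: zero)
qed (rule add)

text \<open>The constraint that a linear functional lie above \<open>\<phi>\<close> on the cone is
  moved into a sublinear bound: a linear functional below \<open>q\<close> is at most
  \<open>- \<phi> c\<close> at \<open>- c\<close>, hence at least \<open>\<phi> c\<close> at
  \<open>c\<close>.\<close>

lemma sublinear_inf_cone:
  fixes p :: "'a::real_vector \<Rightarrow> real"
  assumes p: "sublinear p"
    and C0: "0 \<in> C" and Cadd: "\<And>x y. x \<in> C \<Longrightarrow> y \<in> C \<Longrightarrow> x + y \<in> C"
    and Cscale: "\<And>c x. c > 0 \<Longrightarrow> x \<in> C \<Longrightarrow> c *\<^sub>R x \<in> C"
    and \<phi>add: "\<And>x y. x \<in> C \<Longrightarrow> y \<in> C \<Longrightarrow> \<phi> x + \<phi> y \<le> \<phi> (x + y)"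
    and \<phi>scale: "\<And>c x. c > 0 \<Longrightarrow> x \<in> C \<Longrightarrow> \<phi> (c *\<^sub>R x) = c * \<phi> x"
    and \<phi>p: "\<And>x. x \<in> C \<Longrightarrow> \<phi> x \<le> p x"
  obtains q where "sublinear q" "q \<le> p" "\<And>c. c \<in> C \<Longrightarrow> q (- c) \<le> - \<phi> c"
proof
  define q where "q x = (INF c\<in>C. p (x + c) - \<phi> c)" for x
  \<comment> \<open>Subadditivity gives \<open>p (x + c) + p (- x) \<ge> p c \<ge> \<phi> c\<close>;
    so the infimum defining \<open>q\<close> is finite.\<close>
  have lower: "- p (- x) \<le> p (x + c) - \<phi> c" if "c \<in> C" for x c
    using sublinear_add[OF p, of "x + c" "- x"] \<phi>p[OF that] by simp
  have bdd: "bdd_below ((\<lambda>c. p (x + c) - \<phi> c) ` C)" for x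
    using lower by (auto intro!: bdd_belowI)
  have upper: "q x \<le> p (x + c) - \<phi> c" if "c \<in> C" for x c
    unfolding q_def using bdd that by (rule cINF_lower)
  have greatest: "y \<le> q x" if "\<And>c. c \<in> C \<Longrightarrow> y \<le> p (x + c) - \<phi> c" for x y
    unfolding q_def using C0 that by (intro cINF_greatest) auto
  have \<phi>0: "\<phi> 0 = 0"
    using \<phi>scale[of 2 0] C0 by simp
  show "q \<le> p"
    using upper[OF C0] \<phi>0 by (auto intro!: le_funI)
  show "q (- c) \<le> - \<phi> c" if "c \<in> C" for c
    using upper[OF that, of "- c"] sublinear_zero[OF p] by simp
  show "sublinear q"
  proof (rule sublinearI)
    fix x y
    have *: "q (x + y) \<le> (p (x + c) - \<phi> c) + (p (y + d) - \<phi> d)" if "c \<in> C" "d \<in> C" for c d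
      using upper[OF Cadd[OF that], of "x + y"] \<phi>add[OF that]
        sublinear_add[OF p, of "x + c" "y + d"] by (simp add: algebra_simps)
    have "q (x + y) - (p (x + c) - \<phi> c) \<le> q y" if "c \<in> C" for c
    proof (rule greatest)
      fix d assume "d \<in> C"
      then show "q (x + y) - (p (x + c) - \<phi> c) \<le> p (y + d) - \<phi> d"
        using *[OF that, of d] by linarith
    qed
    then have "q (x + y) - q y \<le> q x"
      by (intro greatest) (simp add: algebra_simps)
    then show "q (x + y) \<le> q x + q y" by simp
  next
    fix c :: real and x assume c: "c > 0"
    have "q (c *\<^sub>R x) / c \<le> q x"
    proof (rule greatest)
      fix d assume d: "d \<in> C"
      have "q (c *\<^sub>R x) \<le> p (c *\<^sub>R (x + d)) - \<phi> (c *\<^sub>R d)"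
        using upper[OF Cscale[OF c d], of "c *\<^sub>R x"] by (simp add: algebra_simps)
      also have "\<dots> = (p (x + d) - \<phi> d) * c"
        using c d by (simp add: sublinear_scale[OF p] \<phi>scale right_diff_distrib mult.commute
            del: scaleR_add_right)
      finally show "q (c *\<^sub>R x) / c \<le> p (x + d) - \<phi> d"
        using c by (simp add: field_simps)
    qed
    then show "q (c *\<^sub>R x) \<le> c * q x"
      using c by (simp add: field_simps)
  next
    have "0 \<le> q 0"
      using lower[of _ 0] sublinear_zero[OF p] by (intro greatest) simp
    then show "q 0 = 0"
      using upper[OF C0, of 0] \<phi>0 sublinear_zero[OF p] by simp
  qed
qed

text \<open>The pointwise infimum of the chain works; this is the bound that Zorn's lemma asks
  for.\<close>

lemma sublinear_chain_inf:
  fixes p :: "'a::real_vector \<Rightarrow> real"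
  assumes p: "sublinear p" and ne: "Q \<noteq> {}"
    and Q: "\<And>q. q \<in> Q \<Longrightarrow> sublinear q \<and> q \<le> p"
    and chain: "\<And>q r. q \<in> Q \<Longrightarrow> r \<in> Q \<Longrightarrow> q \<le> r \<or> r \<le> q"
  shows "\<exists>u. sublinear u \<and> u \<le> p \<and> (\<forall>q\<in>Q. u \<le> q)"
proof -
  define u where "u x = (INF q\<in>Q. q x)" for x
  have lower: "- p (- x) \<le> q x" if "q \<in> Q" for q x
    using sublinear_minus[of q x] Q[OF that] le_funD[of q p "- x"] by force
  have bdd: "bdd_below ((\<lambda>q. q x) ` Q)" for x
    using lower by (auto intro!: bdd_belowI)
  have upper: "u x \<le> q x" if "q \<in> Q" for x q
    unfolding u_def using bdd that by (rule cINF_lower)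
  have greatest: "y \<le> u x" if "\<And>q. q \<in> Q \<Longrightarrow> y \<le> q x" for x y
    unfolding u_def using ne that by (intro cINF_greatest) auto
  have "sublinear u"
  proof (rule sublinearI)
    fix x y
    \<comment> \<open>Comparability enters here: the smaller of \<open>q\<close> and
      \<open>r\<close> is subadditive and lies below the larger one at the other point.\<close>
    have *: "u (x + y) \<le> q x + r y" if "q \<in> Q" "r \<in> Q" for q r
      using chain[OF that]
    proof
      assume "q \<le> r"
      then have "q y \<le> r y" by (rule le_funD)
      then show ?thesis
        using upper[OF that(1), of "x + y"] sublinear_add[of q x y] Q[OF that(1)] by linarith
    next
      assume "r \<le> q"
      then have "r x \<le> q x" by (rule le_funD)
      then show ?thesis
        using upper[OF that(2), of "x + y"] sublinear_add[of r x y] Q[OF that(2)] by linarith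
    qed
    have "u (x + y) - q x \<le> u y" if "q \<in> Q" for q
    proof (rule greatest)
      fix r assume "r \<in> Q"
      then show "u (x + y) - q x \<le> r y"
        using *[OF that, of r] by linarith
    qed
    then have "u (x + y) - u y \<le> u x"
      by (intro greatest) (simp add: algebra_simps)
    then show "u (x + y) \<le> u x + u y" by simp
  next
    fix c :: real and x assume c: "c > 0"
    have "u (c *\<^sub>R x) / c \<le> u x"
    proof (rule greatest)
      fix q assume q: "q \<in> Q"
      show "u (c *\<^sub>R x) / c \<le> q x"
        using upper[OF q, of "c *\<^sub>R x"] Q[OF q] c sublinear_scale[of q c x] by (simp add: field_simps)
    qed
    then show "u (c *\<^sub>R x) \<le> c * u x"
      using c by (simp add: field_simps)
  next
    have "q 0 = 0" if "q \<in> Q" for q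
      using Q[OF that] sublinear_zero by auto
    then have "(\<lambda>q. q 0) ` Q = {0}"
      using ne by force
    then show "u 0 = 0"
      unfolding u_def by simp
  qed
  moreover have "u \<le> p"
  proof (rule le_funI)
    fix x
    obtain q where "q \<in> Q" using ne by auto
    then show "u x \<le> p x"
      using upper[of q x] Q[of q] le_funD[of q p x] by auto
  qed
  ultimately show ?thesis
    using upper by (auto intro!: exI[of _ u] le_funI)
qed

text \<open>A pointwise minimal sublinear functional is odd, hence linear.\<close>

lemma dominated_linear_exists:
  fixes p :: "'a::real_vector \<Rightarrow> real"
  assumes p: "sublinear p"
  obtains f where "linear f" "f \<le> p"
proof -
  define A where "A = {q. sublinear q \<and> q \<le> p}"
  have pA: "p \<in> A" using p by (simp add: A_def)
  have "\<exists>m\<in>A. \<forall>a\<in>A. a \<le> m \<longrightarrow> a = m"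
  proof (rule predicate_Zorn)
    show "partial_order_on A (relation_of (\<lambda>q r. r \<le> q) A)"
      by (rule partial_order_on_relation_ofI) auto
    fix Q assume "Q \<in> Chains (relation_of (\<lambda>q r. r \<le> q) A)"
    then have Q: "\<And>q r. q \<in> Q \<Longrightarrow> r \<in> Q \<Longrightarrow> q \<in> A \<and> (r \<le> q \<or> q \<le> r)"
      by (auto simp: Chains_def relation_of_def)
    show "\<exists>u\<in>A. \<forall>q\<in>Q. u \<le> q"
    proof (cases "Q = {}")
      case False
      have "\<exists>u. sublinear u \<and> u \<le> p \<and> (\<forall>q\<in>Q. u \<le> q)"
        using Q by (intro sublinear_chain_inf[OF p False]) (auto simp: A_def)
      then show ?thesis by (auto simp: A_def)
    qed (use pA in auto)
  qed
  then obtain m where m: "sublinear m" "m \<le> p"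
    and min: "\<And>q. sublinear q \<Longrightarrow> q \<le> m \<Longrightarrow> q = m"
    unfolding A_def by (auto dest: order_trans)
  have odd: "m (- x) = - m x" for x
  proof -
    \<comment> \<open>On the ray through \<open>x\<close> the functional \<open>m\<close> is
      additive, so it can serve as its own lower bound \<open>\<phi>\<close>. The resulting
      \<open>q\<close> equals \<open>m\<close> by minimality, and its bound at \<open>- x\<close> is
      the missing inequality.\<close>
    let ?C = "(\<lambda>t. t *\<^sub>R x) ` {0..}"
    obtain q where q: "sublinear q" "q \<le> m" "\<And>c. c \<in> ?C \<Longrightarrow> q (- c) \<le> - m c"
    proof (rule sublinear_inf_cone[of m ?C m])
      fix y z assume "y \<in> ?C" "z \<in> ?C"
      then obtain s t where st: "y = s *\<^sub>R x" "z = t *\<^sub>R x" "s \<ge> 0" "t \<ge> 0" by auto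
      then show "y + z \<in> ?C" by (auto simp: scaleR_add_left[symmetric])
      have "m ((s + t) *\<^sub>R x) = (s + t) * m x"
        using st by (intro sublinear_scale[OF m(1)]) simp
      then show "m y + m z \<le> m (y + z)"
        using st sublinear_scale[OF m(1)] by (simp add: algebra_simps)
    next
      fix c :: real and y assume "c > 0" "y \<in> ?C"
      then show "c *\<^sub>R y \<in> ?C" by auto
      show "m (c *\<^sub>R y) = c * m y"
        using \<open>c > 0\<close> by (intro sublinear_scale[OF m(1)]) simp
    qed (use m in \<open>auto intro: image_eqI[of _ _ 0]\<close>)
    have "x \<in> ?C" by (auto intro: image_eqI[of _ _ 1])
    then have "m (- x) \<le> - m x"
      using q(3)[of x] min[OF q(1,2)] by simp
    then show ?thesis
      using sublinear_minus[OF m(1), of x] by simp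
  qed
  have "linear m"
  proof (rule linearI)
    fix x y
    show "m (x + y) = m x + m y"
      using sublinear_add[OF m(1), of x y] sublinear_add[OF m(1), of "- x" "- y"] odd[of x] odd[of y]
        odd[of "x + y"] by simp
  next
    fix c x
    show "m (c *\<^sub>R x) = c *\<^sub>R m x"
      using sublinear_scale[OF m(1), of c x] sublinear_scale[OF m(1), of "- c" x] odd[of "c *\<^sub>R x"]
      by (cases "c \<ge> 0") auto
  qed
  with m(2) that show ?thesis by blast
qed

text \<open>Any linear functional below the modified \<open>q\<close> satisfies both bounds. The
  cone will be a ray for norming functionals and the positive cone for positive majorants.\<close>

lemma hahn_banach_sandwich:
  fixes p :: "'a::real_vector \<Rightarrow> real"
  assumes "sublinear p"
    and "0 \<in> C" "\<And>x y. x \<in> C \<Longrightarrow> y \<in> C \<Longrightarrow> x + y \<in> C"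
    and "\<And>c x. c > 0 \<Longrightarrow> x \<in> C \<Longrightarrow> c *\<^sub>R x \<in> C"
    and "\<And>x y. x \<in> C \<Longrightarrow> y \<in> C \<Longrightarrow> \<phi> x + \<phi> y \<le> \<phi> (x + y)"
    and "\<And>c x. c > 0 \<Longrightarrow> x \<in> C \<Longrightarrow> \<phi> (c *\<^sub>R x) = c * \<phi> x"
    and "\<And>x. x \<in> C \<Longrightarrow> \<phi> x \<le> p x"
  obtains f where "linear f" "f \<le> p" "\<And>c. c \<in> C \<Longrightarrow> \<phi> c \<le> f c"
proof -
  obtain q where q: "sublinear q" "q \<le> p" "\<And>c. c \<in> C \<Longrightarrow> q (- c) \<le> - \<phi> c"
    using sublinear_inf_cone[OF assms] by blast
  obtain f where f: "linear f" "f \<le> q"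
    using dominated_linear_exists[OF q(1)] by blast
  have "\<phi> c \<le> f c" if "c \<in> C" for c
    using q(3)[OF that] le_funD[OF f(2), of "- c"] linear_neg[OF f(1), of c] by simp
  with f q(2) that show ?thesis by (meson order_trans)
qed

text \<open>The sandwich theorem with the norm as both bounds: on the ray through \<open>x\<close>
  the norm is additive.\<close>

lemma norming_functional:
  fixes x :: "'a::real_normed_vector"
  obtains f :: "'a \<Rightarrow>\<^sub>L real" where "norm f \<le> 1" "blinfun_apply f x = norm x"
proof -
  let ?C = "(\<lambda>t. t *\<^sub>R x) ` {0..}"
  have sub: "sublinear (norm :: 'a \<Rightarrow> real)"
    by (auto simp: sublinear_def norm_triangle_ineq)
  obtain f where f: "linear f" "f \<le> norm" "\<And>c. c \<in> ?C \<Longrightarrow> norm c \<le> f c"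
  proof (rule hahn_banach_sandwich[OF sub, of ?C norm])
    fix y z assume "y \<in> ?C" "z \<in> ?C"
    then obtain s t where st: "y = s *\<^sub>R x" "z = t *\<^sub>R x" "s \<ge> 0" "t \<ge> 0" by auto
    then show "y + z \<in> ?C" by (auto simp: scaleR_add_left[symmetric])
    show "norm y + norm z \<le> norm (y + z)"
      using st by (simp flip: scaleR_add_left distrib_right)
  qed (auto intro: image_eqI[of _ _ 0])
  have fabs: "\<bar>f y\<bar> \<le> norm y" for y
    using le_funD[OF f(2), of y] le_funD[OF f(2), of "- y"] linear_neg[OF f(1), of y] by simp
  have bl: "bounded_linear f"
    using f(1) fabs by (intro bounded_linear_intro[of f 1]) (auto simp: linear_add linear_scale)
  have "norm (Blinfun f) \<le> 1"
    using fabs by (intro norm_blinfun_bound) (auto simp: bounded_linear_Blinfun_apply[OF bl])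
  moreover have "x \<in> ?C" by (auto intro: image_eqI[of _ _ 1])
  then have "blinfun_apply (Blinfun f) x = norm x"
    using f(3)[of x] fabs[of x] by (simp add: bounded_linear_Blinfun_apply[OF bl])
  ultimately show ?thesis using that by blast
qed

section \<open>Uniform boundedness and weakly null sequences\<close>

lemma uniform_boundedness:
  fixes T :: "nat \<Rightarrow> 'a::banach \<Rightarrow>\<^sub>L 'b::real_normed_vector"
  assumes "\<And>x. bounded (range (\<lambda>n. T n x))"
  shows "bounded (range T)"
proof -
  define K where "K k = {x. \<forall>n. norm (T n x) \<le> real k}" for k :: nat
  have "\<exists>k. x \<in> K k" for x
  proof -
    obtain B where "\<And>n. norm (T n x) \<le> B"
      using assms[of x] by (auto simp: bounded_iff)
    moreover obtain k :: nat where "B \<le> real k" using real_arch_simple by blast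
    ultimately show ?thesis by (auto simp: K_def intro: order_trans)
  qed
  then have cover: "\<Union> (range K) = UNIV" by auto
  have closed: "closed (K k)" for k
    unfolding K_def by (intro closed_Collect_all closed_Collect_le continuous_intros)
  \<comment> \<open>Baire: countably many closed sets cover the complete space, so one of them
    contains a ball.\<close>
  have "\<exists>k. interior (K k) \<noteq> {}"
  proof (rule ccontr)
    assume "\<not> ?thesis"
    then have "interior (\<Union> (range K)) = {}"
      using Met_TC.metric_Baire_category_alt[of "range K"] closed
      by (auto simp: complete_UNIV)
    then show False using cover by simp
  qed
  then obtain k x e where e: "e > 0" "cball x e \<subseteq> K k"
    by (metis all_not_in_conv mem_interior_cball)
  \<comment> \<open>A vector of norm \<open>e\<close> is the difference of two points of the ball,
    at which \<open>T n\<close> has norm at most \<open>k\<close>; the rest is scaling.\<close>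
  have "norm (T n) \<le> 2 * real k / e" for n
  proof (rule norm_blinfun_bound)
    fix y
    show "norm (T n y) \<le> 2 * real k / e * norm y"
    proof (cases "y = 0")
      case False
      let ?z = "(e / norm y) *\<^sub>R y"
      have "norm (T n ?z) = norm (T n (x + ?z) - T n x)"
        by (simp add: blinfun.add_right)
      also have "\<dots> \<le> norm (T n (x + ?z)) + norm (T n x)"
        by (rule norm_triangle_ineq4)
      also have "\<dots> \<le> 2 * real k"
      proof -
        have "x + ?z \<in> K k" "x \<in> K k"
          using e False by (auto simp: dist_norm)
        then show ?thesis by (auto simp: K_def dest!: spec[of _ n])
      qed
      finally show ?thesis
        using e(1) False by (simp add: blinfun.scaleR_right field_simps)
    qed simp
  qed (use e in simp)
  then show ?thesis by (auto intro: boundedI)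
qed

text \<open>Evaluation at a point is a functional on the dual, so weak convergence there implies
  pointwise convergence.\<close>

lemma weakly_null_functionals_bounded:
  fixes f :: "nat \<Rightarrow> 'a::banach \<Rightarrow>\<^sub>L real"
  assumes "weakly_tendsto f 0"
  shows "(\<lambda>n. f n x) \<longlonglongrightarrow> 0" and "bounded (range f)"
proof -
  show lim: "(\<lambda>n. f n x) \<longlonglongrightarrow> 0" for x
  proof -
    have bl: "bounded_linear (\<lambda>g :: 'a \<Rightarrow>\<^sub>L real. blinfun_apply g x)"
      by (rule blinfun.bounded_linear_left)
    show ?thesis
      using assms[unfolded weakly_tendsto_def, rule_format, of "Blinfun (\<lambda>g. blinfun_apply g x)"]
      by (simp add: bounded_linear_Blinfun_apply[OF bl])
  qed
  show "bounded (range f)"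
    by (intro uniform_boundedness convergent_imp_bounded[OF lim])
qed

text \<open>The \<open>x n\<close> are viewed in the bidual, as operators on the dual, which is
  complete. Norming functionals carry the bound back.\<close>

lemma weakly_null_bounded:
  fixes x :: "nat \<Rightarrow> 'a::real_normed_vector"
  assumes "weakly_tendsto x 0"
  shows "bounded (range x)"
proof -
  define J where "J y = Blinfun (\<lambda>f :: 'a \<Rightarrow>\<^sub>L real. f y)" for y
  have J: "blinfun_apply (J y) f = f y" for y f
    unfolding J_def by (subst bounded_linear_Blinfun_apply) (auto intro: blinfun.bounded_linear_left)
  have "bounded (range (\<lambda>n. J (x n)))"
    using assms by (intro uniform_boundedness convergent_imp_bounded[of _ 0])
      (auto simp: J weakly_tendsto_def)
  then obtain B where B: "\<And>n. norm (J (x n)) \<le> B" by (auto simp: bounded_iff)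
  have "norm (x n) \<le> B" for n
  proof -
    obtain f :: "'a \<Rightarrow>\<^sub>L real" where f: "norm f \<le> 1" "f (x n) = norm (x n)"
      by (rule norming_functional)
    have "norm (J (x n) f) \<le> norm (J (x n)) * 1"
      using norm_blinfun[of "J (x n)" f] f(1) by (meson mult_left_mono norm_ge_zero order_trans)
    then show ?thesis using f(2) B[of n] by (simp add: J)
  qed
  then show ?thesis by (auto intro: boundedI)
qed


subsection \<open>Banach lattices\<close>

instance banach_lattice \<subseteq> lattice_ab_group_add ..

lemma lat_abs_nonneg [simp]: "0 \<le> lat_abs (x :: 'a::banach_lattice)"
proof -
  have "x + - x \<le> lat_abs x + lat_abs x"
    unfolding lat_abs_def by (intro add_mono sup_ge1 sup_ge2)
  then show ?thesis by simp
qed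

lemma pprt_le_lat_abs: "pprt x \<le> lat_abs (x :: 'a::banach_lattice)"
  using lat_abs_nonneg[of x] by (simp add: pprt_def lat_abs_def)

lemma lat_abs_minus [simp]: "lat_abs (- x) = lat_abs (x :: 'a::banach_lattice)"
  by (simp add: lat_abs_def sup_commute)

lemma lat_abs_of_nonneg: "0 \<le> x \<Longrightarrow> lat_abs x = (x :: 'a::banach_lattice)"
  unfolding lat_abs_def by (metis neg_le_0_iff_le order_trans sup_absorb1)

lemma norm_lat_abs [simp]: "norm (lat_abs x) = norm (x :: 'a::banach_lattice)"
proof -
  have "sup (lat_abs x) (- lat_abs x) = sup x (- x)"
    using lat_abs_of_nonneg[OF lat_abs_nonneg[of x]] by (simp add: lat_abs_def)
  then show ?thesis
    by (intro order.antisym lattice_norm) simp_all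
qed

lemma norm_le_of_lat_bound:
  fixes x :: "'a::banach_lattice"
  assumes "x \<le> u" "- x \<le> u"
  shows "norm x \<le> norm u"
  using assms by (intro lattice_norm) (meson order_trans le_supI sup_ge1)

lemma norm_mono_nonneg:
  fixes x :: "'a::banach_lattice"
  assumes "0 \<le> x" "x \<le> y"
  shows "norm x \<le> norm y"
  using assms by (intro norm_le_of_lat_bound) (auto intro: order_trans[of _ 0])

lemma norm_pprt_le: "norm (pprt x) \<le> norm (x :: 'a::banach_lattice)"
  using norm_mono_nonneg[OF zero_le_pprt pprt_le_lat_abs, of x] by simp

lemma le_pprt: "x \<le> pprt (x :: 'a::banach_lattice)"
  by (simp add: pprt_def)

lemma pprt_le_iff: "pprt x \<le> y \<longleftrightarrow> x \<le> y \<and> 0 \<le> (y :: 'a::banach_lattice)"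
  by (simp add: pprt_def)

lemma pprt_diff_pprt_minus: "pprt x - pprt (- x) = (x :: 'a::banach_lattice)"
  using prts[of x] by (simp add: pprt_neg)

lemma pprt_add_le: "pprt (x + y) \<le> pprt x + pprt (y :: 'a::banach_lattice)"
  by (simp add: pprt_le_iff add_mono le_pprt)

lemma pprt_diff_eq: "pprt (x - y) = x - inf x (y :: 'a::banach_lattice)"
  by (simp add: pprt_def diff_inf_eq_sup add_sup_distrib_left sup_commute)

lemma inf_add_pprt_diff: "inf x y + pprt (x - y) = (x :: 'a::banach_lattice)"
  by (metis add.commute diff_add_cancel pprt_diff_eq)

lemma pprt_scaleR:
  fixes x :: "'a::banach_lattice"
  assumes "c > 0"
  shows "pprt (c *\<^sub>R x) = c *\<^sub>R pprt x"
proof (rule order.antisym)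
  have le: "pprt (d *\<^sub>R y) \<le> d *\<^sub>R pprt y" if "d > 0" for d and y :: 'a
    using that by (simp add: pprt_le_iff scaleR_left_mono le_pprt scaleR_nonneg_nonneg)
  show "pprt (c *\<^sub>R x) \<le> c *\<^sub>R pprt x"
    by (rule le[OF assms])
  have "pprt x \<le> inverse c *\<^sub>R pprt (c *\<^sub>R x)"
    using le[of "inverse c" "c *\<^sub>R x"] assms by simp
  then show "c *\<^sub>R pprt x \<le> pprt (c *\<^sub>R x)"
    using assms by (simp add: pos_le_divideR_eq)
qed

text \<open>Let \<open>a\<close> and \<open>b\<close> be the two positive parts. Then
  \<open>a - b = x - y\<close>, so \<open>a - inf a b = pprt (a - b) = a\<close>.\<close>

lemma inf_pprt_diff: "inf (pprt (x - y)) (pprt (y - x)) = (0 :: 'a::banach_lattice)"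
proof -
  have "pprt (x - y) - inf (pprt (x - y)) (pprt (y - x)) = pprt (pprt (x - y) - pprt (y - x))"
    by (rule pprt_diff_eq[symmetric])
  also have "pprt (x - y) - pprt (y - x) = x - y"
    using pprt_diff_pprt_minus[of "x - y"] by simp
  finally show ?thesis
    by (metis add_diff_cancel_left' cancel_comm_monoid_add_class.diff_cancel diff_add_cancel)
qed

text \<open>By distributivity the right side is the infimum of \<open>a + b\<close>,
  \<open>a + c\<close>, \<open>c + b\<close> and \<open>c + c\<close>, and the left side is below
  each of these.\<close>

lemma inf_add_le:
  fixes a b c :: "'a::banach_lattice"
  assumes "0 \<le> a" "0 \<le> b" "0 \<le> c"
  shows "inf (a + b) c \<le> inf a c + inf b c"
proof -
  have "inf (a + b) c \<le> a + c" "inf (a + b) c \<le> c + b" "inf (a + b) c \<le> c + c"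
    using assms by (auto intro: le_infI2 add_increasing add_increasing2)
  then show ?thesis
    by (simp add: add_inf_distrib_left add_inf_distrib_right)
qed

text \<open>An explicit Riesz decomposition. It reduces estimates on \<open>{0..a + b}\<close> to
  estimates on \<open>{0..a}\<close> and \<open>{0..b}\<close>.\<close>

lemma riesz_decomposition:
  fixes a b y :: "'a::banach_lattice"
  assumes "0 \<le> y" "y \<le> a + b" "0 \<le> a" "0 \<le> b"
  shows "inf y a \<in> {0..a}" "pprt (y - a) \<in> {0..b}" "y = inf y a + pprt (y - a)"
proof -
  show "inf y a \<in> {0..a}" using assms by simp
  show "pprt (y - a) \<in> {0..b}" using assms by (simp add: pprt_le_iff algebra_simps)
  show "y = inf y a + pprt (y - a)" by (rule inf_add_pprt_diff[symmetric])
qed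

text \<open>The negative part of \<open>l\<close> is dominated by \<open>pprt (x n - l)\<close>,
  whose norm tends to \<open>0\<close>.\<close>

lemma nonneg_limit:
  fixes x :: "nat \<Rightarrow> 'a::banach_lattice"
  assumes lim: "x \<longlonglongrightarrow> l" and nonneg: "\<And>n. 0 \<le> x n"
  shows "0 \<le> l"
proof -
  have "norm (pprt (- l)) \<le> norm (x n - l)" for n
  proof -
    have "pprt (- l) \<le> pprt (x n - l)"
      using nonneg by (intro pprt_mono) simp
    then have "norm (pprt (- l)) \<le> norm (pprt (x n - l))"
      by (intro norm_mono_nonneg) simp_all
    then show ?thesis using norm_pprt_le by (rule order_trans)
  qed
  moreover have "(\<lambda>n. norm (x n - l)) \<longlonglongrightarrow> 0"
    using lim by (simp add: LIM_zero tendsto_norm_zero)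
  ultimately have "norm (pprt (- l)) \<le> 0"
    by (intro LIMSEQ_le_const) auto
  then show ?thesis
    using le_pprt[of "- l"] by simp
qed

lemma term_le_suminf:
  fixes x :: "nat \<Rightarrow> 'a::banach_lattice"
  assumes "summable x" "\<And>n. 0 \<le> x n"
  shows "x k \<le> suminf x"
proof -
  have "(\<lambda>n. sum x {..<n + Suc k} - x k) \<longlonglongrightarrow> suminf x - x k"
    by (intro tendsto_diff tendsto_const LIMSEQ_ignore_initial_segment[OF summable_LIMSEQ[OF assms(1)]])
  moreover have "0 \<le> sum x {..<n + Suc k} - x k" for n
    using assms(2) sum_mono2[of "{..<n + Suc k}" "{k}" x] by simp
  ultimately have "0 \<le> suminf x - x k"
    by (rule nonneg_limit)
  then show ?thesis by simp
qed

text \<open>A linear functional below \<open>\<lambda>x. M * norm (pprt x)\<close> is nonpositive on the negative cone, i.e. positive.\<close>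

lemma positive_functional_above:
  fixes \<phi> :: "'a::banach_lattice \<Rightarrow>\<^sub>L real"
  shows "\<exists>g :: 'a \<Rightarrow>\<^sub>L real. \<forall>x\<ge>0. 0 \<le> blinfun_apply g x \<and> \<phi> x \<le> g x"
proof -
  define p where "p x = norm \<phi> * norm (pprt x)" for x :: 'a
  have "sublinear p"
  proof (rule sublinearI)
    fix x y :: 'a
    have "norm (pprt (x + y)) \<le> norm (pprt x + pprt y)"
      by (rule norm_mono_nonneg[OF zero_le_pprt pprt_add_le])
    then have "norm (pprt (x + y)) \<le> norm (pprt x) + norm (pprt y)"
      using norm_triangle_ineq[of "pprt x" "pprt y"] by linarith
    then show "p (x + y) \<le> p x + p y"
      unfolding p_def distrib_left[symmetric] by (rule mult_left_mono) simp
  qed (auto simp: p_def pprt_scaleR)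
  then obtain f where f: "linear f" "f \<le> p" "\<And>c. c \<in> {0..} \<Longrightarrow> \<phi> c \<le> f c"
  proof (rule hahn_banach_sandwich[where C = "{0..}" and \<phi> = \<phi>])
    fix x :: 'a assume "x \<in> {0..}"
    then show "\<phi> x \<le> p x"
      using norm_blinfun[of \<phi> x] by (simp add: p_def)
  qed (auto simp: blinfun.add_right blinfun.scaleR_right scaleR_nonneg_nonneg)
  have p_le: "p x \<le> norm \<phi> * norm x" for x
    by (simp add: p_def mult_left_mono norm_pprt_le)
  have fabs: "\<bar>f x\<bar> \<le> norm x * norm \<phi>" for x
    using le_funD[OF f(2), of x] le_funD[OF f(2), of "- x"] linear_neg[OF f(1), of x]
      p_le[of x] p_le[of "- x"] by (simp add: mult.commute)
  have bl: "bounded_linear f"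
    using f(1) fabs by (intro bounded_linear_intro[of f "norm \<phi>"]) (auto simp: linear_add linear_scale)
  show ?thesis
  proof (intro exI allI impI conjI)
    fix x :: 'a assume "0 \<le> x"
    then show "0 \<le> blinfun_apply (Blinfun f) x" "\<phi> x \<le> blinfun_apply (Blinfun f) x"
      using le_funD[OF f(2), of "- x"] linear_neg[OF f(1), of x] f(3)[of x]
      by (auto simp: bounded_linear_Blinfun_apply[OF bl] p_def)
  qed
qed

section \<open>Weakly null and uaw-null sequences in Banach lattices\<close>

lemma weakly_null_dominated:
  fixes y z :: "nat \<Rightarrow> 'a::banach_lattice"
  assumes z: "weakly_tendsto z 0" and y: "\<And>n. 0 \<le> y n" "\<And>n. y n \<le> z n"
  shows "weakly_tendsto y 0"
  unfolding weakly_tendsto_def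
proof
  fix \<phi> :: "'a \<Rightarrow>\<^sub>L real"
  \<comment> \<open>With a positive \<open>g\<close> above \<open>\<psi>\<close> on the cone,
    \<open>\<psi> (y n) \<le> g (y n) \<le> g (z n)\<close>. Taking \<open>\<phi>\<close> and
    \<open>- \<phi>\<close> for \<open>\<psi>\<close> squeezes \<open>\<phi> (y n)\<close>.\<close>
  have upper: "\<exists>b. b \<longlonglongrightarrow> 0 \<and> (\<forall>n. \<psi> (y n) \<le> b n)" for \<psi> :: "'a \<Rightarrow>\<^sub>L real"
  proof -
    obtain g :: "'a \<Rightarrow>\<^sub>L real" where g: "\<forall>x\<ge>0. 0 \<le> g x \<and> \<psi> x \<le> g x"
      using positive_functional_above[of \<psi>] by blast
    have "\<psi> (y n) \<le> g (z n)" for n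
    proof -
      have "0 \<le> g (z n - y n)" "\<psi> (y n) \<le> g (y n)"
        using g y by auto
      then show ?thesis by (simp add: blinfun.diff_right)
    qed
    moreover have "(\<lambda>n. g (z n)) \<longlonglongrightarrow> 0"
      using z by (simp add: weakly_tendsto_def)
    ultimately show ?thesis by blast
  qed
  obtain b where b: "b \<longlonglongrightarrow> 0" "\<And>n. \<phi> (y n) \<le> b n"
    using upper[of \<phi>] by blast
  obtain c where c: "c \<longlonglongrightarrow> 0" "\<And>n. - \<phi> (y n) \<le> c n"
    using upper[of "- \<phi>"] unfolding blinfun.minus_left by blast
  have "(\<lambda>n. - c n) \<longlonglongrightarrow> 0"
    using tendsto_minus[OF c(1)] by simp
  moreover have "- c n \<le> \<phi> (y n)" for n
    using c(2)[of n] by linarith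
  ultimately have "(\<lambda>n. \<phi> (y n)) \<longlonglongrightarrow> 0"
    using b by (auto intro: tendsto_sandwich[of "\<lambda>n. - c n" _ _ b, rotated 2])
  then show "(\<lambda>n. \<phi> (y n)) \<longlonglongrightarrow> \<phi> 0" by simp
qed

text \<open>The sum of disjoint positive elements is their supremum.\<close>

lemma disjoint_sum_le:
  fixes d :: "'i \<Rightarrow> 'a::banach_lattice"
  assumes "finite I" "\<And>i. i \<in> I \<Longrightarrow> 0 \<le> d i" "\<And>i. i \<in> I \<Longrightarrow> d i \<le> u" "0 \<le> u"
    and "\<And>i j. i \<in> I \<Longrightarrow> j \<in> I \<Longrightarrow> i \<noteq> j \<Longrightarrow> inf (d i) (d j) = 0"
  shows "sum d I \<le> u"
proof -
  \<comment> \<open>The claim is strengthened for the induction: a partial sum is disjoint from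
    every positive element disjoint from all its summands, in particular from the next
    summand.\<close>
  have "sum d I \<le> u \<and> (\<forall>w\<ge>0. (\<forall>i\<in>I. inf (d i) w = 0) \<longrightarrow> inf (sum d I) w = 0)"
    using assms
  proof (induction I rule: finite_induct)
    case (insert i I)
    have I: "sum d I \<le> u" "\<And>w. 0 \<le> w \<Longrightarrow> (\<And>j. j \<in> I \<Longrightarrow> inf (d j) w = 0) \<Longrightarrow> inf (sum d I) w = 0"
      using insert by auto
    have pos: "0 \<le> sum d I" "0 \<le> d i"
      using insert.prems by (auto intro: sum_nonneg)
    have "inf (sum d I) (d i) = 0"
      using insert.hyps insert.prems by (intro I(2)) auto
    then have "d i + sum d I = sup (d i) (sum d I)"
      using add_eq_inf_sup[of "d i" "sum d I"] by (simp add: inf_commute)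
    then have "sum d (insert i I) \<le> u"
      using insert.hyps insert.prems I(1) by simp
    moreover have "inf (sum d (insert i I)) w = 0" if "0 \<le> w" "\<forall>j\<in>insert i I. inf (d j) w = 0" for w
    proof (rule order.antisym)
      have "inf (sum d (insert i I)) w \<le> inf (d i) w + inf (sum d I) w"
        using inf_add_le[OF pos(2,1) that(1)] insert.hyps by simp
      also have "\<dots> = 0"
        using that I(2)[OF that(1)] by simp
      finally show "inf (sum d (insert i I)) w \<le> 0" .
      show "0 \<le> inf (sum d (insert i I)) w"
        using pos that(1) insert.hyps by simp
    qed
    ultimately show ?case by blast
  qed (auto simp: inf_absorb1)
  then show ?thesis ..
qed

text \<open>The values of a functional are even absolutely summable: sums of the \<open>d n\<close>
  with signs stay between \<open>- u\<close> and \<open>u\<close>, so their norms are at most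
  \<open>norm u\<close>.\<close>

lemma disjoint_order_bounded_weakly_null:
  fixes d :: "nat \<Rightarrow> 'a::banach_lattice"
  assumes d: "\<And>n. 0 \<le> d n" "\<And>n. d n \<le> u"
    and disj: "\<And>m n. m \<noteq> n \<Longrightarrow> inf (d m) (d n) = 0"
  shows "weakly_tendsto d 0"
  unfolding weakly_tendsto_def
proof
  fix \<phi> :: "'a \<Rightarrow>\<^sub>L real"
  have u: "0 \<le> u" using d[of 0] by (rule order_trans)
  have "summable (\<lambda>n. \<bar>\<phi> (d n)\<bar>)"
  proof (rule summableI_nonneg_bounded)
    fix N
    define s where "s n = sgn (\<phi> (d n))" for n
    let ?w = "\<Sum>n<N. s n *\<^sub>R d n"
    have s: "t * s n \<le> 1" if "\<bar>t\<bar> = 1" for n t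
      using that by (auto simp: s_def sgn_if)
    \<comment> \<open>The factor \<open>t\<close>, equal to \<open>1\<close> or \<open>- 1\<close>,
      treats \<open>?w\<close> and \<open>- ?w\<close> together.\<close>
    have le: "(\<Sum>n<N. (t * s n) *\<^sub>R d n) \<le> u" if "\<bar>t\<bar> = 1" for t
    proof -
      have "(\<Sum>n<N. (t * s n) *\<^sub>R d n) \<le> sum d {..<N}"
      proof (rule sum_mono)
        fix n
        show "(t * s n) *\<^sub>R d n \<le> d n"
          using scaleR_right_mono[OF s[OF that] d(1), of n] by simp
      qed
      also have "\<dots> \<le> u"
        by (rule disjoint_sum_le) (simp_all add: d u disj)
      finally show ?thesis .
    qed
    have "norm ?w \<le> norm u"
      using le[of 1] le[of "- 1"] by (intro norm_le_of_lat_bound) (simp_all add: sum_negf)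
    have "\<bar>\<phi> (d n)\<bar> = s n * \<phi> (d n)" for n
      by (simp add: s_def sgn_if)
    then have "(\<Sum>n<N. \<bar>\<phi> (d n)\<bar>) = \<phi> ?w"
      by (simp add: blinfun.sum_right blinfun.scaleR_right)
    also have "\<dots> \<le> norm \<phi> * norm ?w"
      using norm_blinfun[of \<phi> ?w] by simp
    also have "\<dots> \<le> norm \<phi> * norm u"
      using \<open>norm ?w \<le> norm u\<close> by (intro mult_left_mono) simp_all
    finally show "(\<Sum>n<N. \<bar>\<phi> (d n)\<bar>) \<le> norm \<phi> * norm u" .
  qed (rule abs_ge_zero)
  then have "(\<lambda>n. \<phi> (d n)) \<longlonglongrightarrow> 0"
    by (rule summable_LIMSEQ_zero[OF summable_rabs_cancel])
  then show "(\<lambda>n. \<phi> (d n)) \<longlonglongrightarrow> \<phi> 0" by simp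
qed

text \<open>Truncating at \<open>u\<close> keeps the sequence disjoint and makes it order
  bounded.\<close>

lemma disjoint_uaw_null:
  fixes v :: "nat \<Rightarrow> 'a::banach_lattice"
  assumes v: "\<And>n. 0 \<le> v n" and disj: "\<And>m n. m \<noteq> n \<Longrightarrow> inf (v m) (v n) = 0"
  shows "uaw_tendsto v 0"
  unfolding uaw_tendsto_def
proof (intro allI impI)
  fix u :: 'a assume u: "0 \<le> u"
  have "weakly_tendsto (\<lambda>n. inf (v n) u) 0"
  proof (rule disjoint_order_bounded_weakly_null[where u = u])
    fix m n :: nat assume "m \<noteq> n"
    have "inf (inf (v m) u) (inf (v n) u) \<le> inf (v m) (v n)"
      by (intro inf_mono inf_le1)
    then show "inf (inf (v m) u) (inf (v n) u) = 0"
      using disj[OF \<open>m \<noteq> n\<close>] v u by (intro order.antisym) auto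
  qed (simp_all add: v u)
  then show "weakly_tendsto (\<lambda>n. inf (lat_abs (v n - 0)) u) 0"
    using v by (simp add: lat_abs_of_nonneg)
qed


subsection \<open>Positive uaw-Dunford--Pettis operators\<close>

lemma positive_op_mono:
  assumes "positive_op T" "x \<le> y"
  shows "blinfun_apply T x \<le> T y"
  using assms(1)[unfolded positive_op_def, rule_format, of "y - x"] assms(2)
  by (simp add: blinfun.diff_right)

lemma positive_op_nonneg: "positive_op T \<Longrightarrow> 0 \<le> x \<Longrightarrow> 0 \<le> blinfun_apply T x"
  by (simp add: positive_op_def)

text \<open>
  Subtracting \<open>4 ^ n\<close> times the preceding terms makes a sequence almost disjoint; subtracting in
  addition the summable tail \<open>(1 / 2) ^ n *\<^sub>R x\<close> makes it disjoint.
\<close>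

lemma uaw_dunford_pettis_almost_dominated:
  fixes T :: "'e::banach_lattice \<Rightarrow>\<^sub>L 'f::banach_lattice"
  assumes T: "positive_op T" "uaw_dunford_pettis T"
    and A: "bounded A" "\<And>y. y \<in> A \<Longrightarrow> 0 \<le> y" and e: "e > 0"
  shows "\<exists>u\<ge>0. \<forall>y\<in>A. norm (T (pprt (y - u))) \<le> e"
proof (rule ccontr)
  assume "\<not> ?thesis"
  then have "\<forall>u. \<exists>y. 0 \<le> u \<longrightarrow> y \<in> A \<and> e < norm (T (pprt (y - u)))"
    by (meson not_le)
  then obtain pick where pick: "\<And>u. 0 \<le> u \<Longrightarrow> pick u \<in> A \<and> e < norm (T (pprt (pick u - u)))"
    by metis
  \<comment> \<open>\<open>s n\<close> is the sum of the \<open>y k\<close> with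
    \<open>k < n\<close>, and \<open>y n\<close> is a counterexample to the claim at the threshold
    \<open>4 ^ n *\<^sub>R s n\<close>.\<close>
  define s where "s = rec_nat 0 (\<lambda>n t. t + pick (4 ^ n *\<^sub>R t))"
  define y where "y n = pick (4 ^ n *\<^sub>R s n)" for n
  have s_Suc: "s (Suc n) = s n + y n" for n
    by (simp add: s_def y_def)
  have s_nonneg: "0 \<le> s n" for n
  proof (induction n)
    case (Suc n)
    then have "y n \<in> A"
      using pick[of "4 ^ n *\<^sub>R s n"] by (simp add: y_def scaleR_nonneg_nonneg)
    with Suc A(2)[of "y n"] show ?case by (simp add: s_Suc)
  qed (simp add: s_def)
  have y: "y n \<in> A" "e < norm (T (pprt (y n - 4 ^ n *\<^sub>R s n)))" for n
    using pick[of "4 ^ n *\<^sub>R s n"] s_nonneg[of n] by (simp_all add: y_def scaleR_nonneg_nonneg)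
  have y_nonneg: "0 \<le> y n" for n
    using y(1) by (rule A(2))
  have y_le_s: "y n \<le> s m" if "n < m" for n m
    using that
  proof (induction m)
    case (Suc m)
    then show ?case
      using s_nonneg[of m] y_nonneg[of m]
      by (cases "n = m") (auto simp: s_Suc add_increasing add_increasing2 less_Suc_eq)
  qed simp
  obtain B where B: "\<And>n. norm (y n) \<le> B"
    using A(1) y(1) unfolding bounded_iff by blast
  have summable: "summable (\<lambda>n. (1 / 2) ^ n *\<^sub>R y n)"
  proof (rule summable_comparison_test')
    show "summable (\<lambda>n. (1 / 2 :: real) ^ n * B)"
      by (intro summable_mult2 summable_geometric) simp
    show "norm ((1 / 2) ^ n *\<^sub>R y n) \<le> (1 / 2) ^ n * B" if "n \<ge> 0" for n
      using B[of n] by (simp add: divide_right_mono power_one_over)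
  qed
  define x where "x = (\<Sum>n. (1 / 2) ^ n *\<^sub>R y n)"
  have x_ge: "(1 / 2) ^ n *\<^sub>R y n \<le> x" for n
    unfolding x_def by (rule term_le_suminf[OF summable]) (simp add: y_nonneg scaleR_nonneg_nonneg)
  have x_nonneg: "0 \<le> x"
    using x_ge[of 0] y_nonneg[of 0] by simp
  have y_le_x: "y n \<le> 2 ^ n *\<^sub>R x" for n
  proof -
    have "2 ^ n *\<^sub>R ((1 / 2) ^ n *\<^sub>R y n) \<le> 2 ^ n *\<^sub>R x"
      by (rule scaleR_left_mono[OF x_ge]) simp
    then show ?thesis by (simp add: power_one_over)
  qed
  define v where "v n = pprt (y n - 4 ^ n *\<^sub>R s n - (1 / 2) ^ n *\<^sub>R x)" for n
  have v_nonneg: "0 \<le> v n" for n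
    by (simp add: v_def)
  have disj: "inf (v n) (v m) = 0" if "n < m" for n m
  proof -
    \<comment> \<open>The factor \<open>K\<close> turns the subtracted
      \<open>(1 / 2) ^ n *\<^sub>R x\<close> into \<open>2 ^ m *\<^sub>R x\<close>, which dominates
      \<open>y m\<close>. Since \<open>n < m\<close>, also \<open>K \<le> 4 ^ m\<close>, so
      \<open>4 ^ m *\<^sub>R s m\<close> dominates \<open>K *\<^sub>R y n\<close>. Hence
      \<open>v n\<close> and \<open>v m\<close> lie below the positive and the negative part of the
      same element \<open>K *\<^sub>R y n - y m\<close>.\<close>
    define K where "K = (2 :: real) ^ (n + m)"
    have K: "1 \<le> K" "K \<le> 4 ^ m"
    proof -
      have "K \<le> 2 ^ (2 * m)"
        unfolding K_def using that by (intro power_increasing) simp_all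
      then show "K \<le> 4 ^ m" by (simp add: power_mult)
      show "1 \<le> K" by (simp add: K_def)
    qed
    have "K *\<^sub>R (y n - 4 ^ n *\<^sub>R s n - (1 / 2) ^ n *\<^sub>R x) = K *\<^sub>R y n - K *\<^sub>R 4 ^ n *\<^sub>R s n - 2 ^ m *\<^sub>R x"
      by (simp add: K_def scaleR_diff_right power_add power_one_over)
    also have "\<dots> \<le> K *\<^sub>R y n - y m"
    proof -
      have "0 \<le> K *\<^sub>R 4 ^ n *\<^sub>R s n"
        using K(1) s_nonneg[of n] by (simp add: scaleR_nonneg_nonneg)
      then show ?thesis
        using y_le_x[of m] by (simp add: diff_diff_eq add_increasing diff_left_mono)
    qed
    finally have "K *\<^sub>R v n \<le> pprt (K *\<^sub>R y n - y m)"
      using K(1) unfolding v_def by (subst pprt_scaleR[symmetric]) (auto intro: pprt_mono)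
    moreover have "v n \<le> K *\<^sub>R v n"
      using scaleR_right_mono[OF K(1) v_nonneg[of n]] by simp
    ultimately have n: "v n \<le> pprt (K *\<^sub>R y n - y m)"
      by (rule order_trans[rotated])
    have "K *\<^sub>R y n \<le> 4 ^ m *\<^sub>R s m"
      using K y_nonneg[of n] y_le_s[OF that] by (intro scaleR_mono) simp_all
    then have "y m - 4 ^ m *\<^sub>R s m - (1 / 2) ^ m *\<^sub>R x \<le> y m - K *\<^sub>R y n"
      using x_nonneg by (simp add: diff_diff_eq add_increasing2 diff_left_mono scaleR_nonneg_nonneg)
    then have m: "v m \<le> pprt (y m - K *\<^sub>R y n)"
      unfolding v_def by (rule pprt_mono)
    have "inf (v n) (v m) \<le> 0"
      using inf_mono[OF n m] by (simp add: inf_pprt_diff)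
    then show ?thesis
      using v_nonneg by (intro order.antisym) simp_all
  qed
  have "uaw_tendsto v 0"
  proof (rule disjoint_uaw_null[OF v_nonneg])
    fix m n :: nat assume "m \<noteq> n"
    then show "inf (v m) (v n) = 0"
      using disj[of m n] disj[of n m] by (cases "m < n") (simp_all add: inf_commute)
  qed
  moreover have "bounded (range v)"
  proof (rule boundedI[of _ B])
    fix z assume "z \<in> range v"
    then obtain n where n: "z = v n" by auto
    have "0 \<le> 4 ^ n *\<^sub>R s n + (1 / 2) ^ n *\<^sub>R x"
      using s_nonneg[of n] x_nonneg by (intro add_nonneg_nonneg scaleR_nonneg_nonneg) simp_all
    then have "v n \<le> y n"
      using y_nonneg[of n] by (simp only: v_def pprt_le_iff diff_diff_eq diff_le_eq) simp
    then show "norm z \<le> B"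
      using norm_mono_nonneg[OF v_nonneg] B[of n] n order_trans by blast
  qed
  ultimately have Tv: "(\<lambda>n. norm (T (v n))) \<longlonglongrightarrow> 0"
    using T(2) by (simp add: uaw_dunford_pettis_def)
  \<comment> \<open>Undoing the subtraction of the tail costs only
    \<open>(1 / 2) ^ n * norm (T x)\<close>, so \<open>norm (T (v n))\<close> cannot tend to
    \<open>0\<close>.\<close>
  have "e \<le> norm (T (v n)) + (1 / 2) ^ n * norm (T x)" for n
  proof -
    have "pprt (y n - 4 ^ n *\<^sub>R s n) \<le> v n + (1 / 2) ^ n *\<^sub>R x"
      using pprt_add_le[of "y n - 4 ^ n *\<^sub>R s n - (1 / 2) ^ n *\<^sub>R x" "(1 / 2) ^ n *\<^sub>R x"] x_nonneg
      by (simp add: v_def scaleR_nonneg_nonneg)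
    then have "norm (T (pprt (y n - 4 ^ n *\<^sub>R s n))) \<le> norm (T (v n + (1 / 2) ^ n *\<^sub>R x))"
      by (intro norm_mono_nonneg positive_op_nonneg[OF T(1)] positive_op_mono[OF T(1)]) simp_all
    also have "\<dots> \<le> norm (T (v n)) + norm (T ((1 / 2) ^ n *\<^sub>R x))"
      unfolding blinfun.add_right by (rule norm_triangle_ineq)
    also have "norm (T ((1 / 2) ^ n *\<^sub>R x)) = (1 / 2) ^ n * norm (T x)"
      by (simp add: blinfun.scaleR_right)
    finally show ?thesis using y(2)[of n] by linarith
  qed
  moreover have "(\<lambda>n. norm (T (v n)) + (1 / 2) ^ n * norm (T x)) \<longlonglongrightarrow> 0 + 0 * norm (T x)"
    by (intro tendsto_add Tv tendsto_mult_right LIMSEQ_power_zero) simp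
  ultimately have "e \<le> 0 + 0 * norm (T x)"
    by (intro LIMSEQ_le_const) auto
  with e show False by simp
qed

text \<open>Splitting \<open>x = pprt x - pprt (- x)\<close> and truncating both parts at the \<open>u\<close> of the preceding lemma.\<close>

lemma weak_dunford_pettis_if_uniform_limit:
  fixes T :: "'e::banach_lattice \<Rightarrow>\<^sub>L 'f::banach_lattice"
  assumes T: "positive_op T" "uaw_dunford_pettis T"
    and unif: "\<And>(f :: nat \<Rightarrow> 'f \<Rightarrow>\<^sub>L real) v. weakly_tendsto f 0 \<Longrightarrow> 0 \<le> v \<Longrightarrow>
      uniform_limit {0..v} (\<lambda>n. blinfun_apply (f n)) (\<lambda>_. 0) sequentially"
  shows "weak_dunford_pettis T"
  unfolding weak_dunford_pettis_def
proof (intro allI impI)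
  fix x :: "nat \<Rightarrow> 'e" and f :: "nat \<Rightarrow> 'f \<Rightarrow>\<^sub>L real"
  assume x: "weakly_tendsto x 0" and f: "weakly_tendsto f 0"
  obtain B where B: "\<And>n. norm (x n) \<le> B"
    using weakly_null_bounded[OF x] by (auto simp: bounded_iff)
  obtain M where M: "M > 0" "\<And>n. norm (f n) \<le> M"
    using weakly_null_functionals_bounded(2)[OF f] by (auto simp: bounded_pos)
  show "(\<lambda>n. f n (T (x n))) \<longlonglongrightarrow> 0"
  proof (rule tendstoI)
    fix e :: real assume e: "e > 0"
    \<comment> \<open>Each of the two parts of \<open>x n\<close> splits into a truncation and a
      remainder. As \<open>norm (f n) \<le> M\<close>, this constant gives \<open>e / 4\<close> for
      each remainder.\<close>
    have "\<exists>u\<ge>0. \<forall>y\<in>range (\<lambda>n. lat_abs (x n)). norm (T (pprt (y - u))) \<le> e / (4 * M)"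
      using B e M(1) by (intro uaw_dunford_pettis_almost_dominated[OF T]) (auto intro!: boundedI)
    then obtain u where u: "0 \<le> u" "\<And>n. norm (T (pprt (lat_abs (x n) - u))) \<le> e / (4 * M)"
      by auto
    have "\<forall>\<^sub>F n in sequentially. \<forall>y\<in>{0..T u}. dist (f n y) 0 < e / 4"
      using unif[OF f positive_op_nonneg[OF T(1) u(1)]] e by (intro uniform_limitD) simp_all
    then show "\<forall>\<^sub>F n in sequentially. dist (f n (T (x n))) 0 < e"
    proof eventually_elim
      fix n assume *: "\<forall>y\<in>{0..T u}. dist (f n y) 0 < e / 4"
      have part: "\<bar>f n (T p)\<bar> < e / 2" if p: "0 \<le> p" "p \<le> lat_abs (x n)" for p
      proof -
        have "T (inf p u) \<in> {0..T u}"
          using p u(1) positive_op_mono[OF T(1), of "inf p u" u] by (simp add: positive_op_nonneg[OF T(1)])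
        then have 1: "\<bar>f n (T (inf p u))\<bar> < e / 4"
          using * by (simp add: dist_real_def)
        have "norm (T (pprt (p - u))) \<le> norm (T (pprt (lat_abs (x n) - u)))"
          using p by (intro norm_mono_nonneg positive_op_nonneg[OF T(1)] positive_op_mono[OF T(1)]
              zero_le_pprt pprt_mono diff_right_mono)
        also have "\<dots> \<le> e / (4 * M)" by (rule u(2))
        finally have "norm (f n) * norm (T (pprt (p - u))) \<le> M * (e / (4 * M))"
          using M by (intro mult_mono) simp_all
        then have 2: "\<bar>f n (T (pprt (p - u)))\<bar> \<le> e / 4"
          using norm_blinfun[of "f n" "T (pprt (p - u))"] M(1) by simp
        have "f n (T p) = f n (T (inf p u)) + f n (T (pprt (p - u)))"
          by (simp add: inf_add_pprt_diff flip: blinfun.add_right)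
        then show ?thesis using 1 2 by linarith
      qed
      have "f n (T (x n)) = f n (T (pprt (x n))) - f n (T (pprt (- x n)))"
        by (simp add: pprt_diff_pprt_minus flip: blinfun.diff_right)
      then show "dist (f n (T (x n))) 0 < e"
        using part[OF zero_le_pprt pprt_le_lat_abs] part[OF zero_le_pprt, of "- x n"]
          pprt_le_lat_abs[of "- x n"] by (simp add: dist_real_def)
    qed
  qed
qed

text \<open>The truncations of \<open>lat_abs (x n)\<close> are dominated by a weakly null sequence,
  so \<open>x\<close> is uaw-null; the boundedness of \<open>f\<close> does the rest.\<close>

lemma weak_dunford_pettis_if_weakly_seq_cont:
  fixes T :: "'e::banach_lattice \<Rightarrow>\<^sub>L 'f::banach"
  assumes T: "uaw_dunford_pettis T" and E: "weakly_seq_cont_lattice_ops TYPE('e)"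
  shows "weak_dunford_pettis T"
  unfolding weak_dunford_pettis_def
proof (intro allI impI)
  fix x :: "nat \<Rightarrow> 'e" and f :: "nat \<Rightarrow> 'f \<Rightarrow>\<^sub>L real"
  assume x: "weakly_tendsto x 0" and f: "weakly_tendsto f 0"
  obtain M where M: "\<And>n. norm (f n) \<le> M"
    using weakly_null_functionals_bounded(2)[OF f] by (auto simp: bounded_iff)
  have abs: "weakly_tendsto (\<lambda>n. lat_abs (x n)) 0"
    using E x by (simp add: weakly_seq_cont_lattice_ops_def)
  have "uaw_tendsto x 0"
    unfolding uaw_tendsto_def
  proof (intro allI impI)
    fix u :: 'e assume "0 \<le> u"
    then show "weakly_tendsto (\<lambda>n. inf (lat_abs (x n - 0)) u) 0"
      by (intro weakly_null_dominated[OF abs]) simp_all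
  qed
  then have "(\<lambda>n. norm (T (x n))) \<longlonglongrightarrow> 0"
    using T weakly_null_bounded[OF x] by (simp add: uaw_dunford_pettis_def)
  then have lim: "(\<lambda>n. M * norm (T (x n))) \<longlonglongrightarrow> 0"
    by (rule tendsto_mult_right_zero)
  show "(\<lambda>n. f n (T (x n))) \<longlonglongrightarrow> 0"
  proof (rule Lim_null_comparison[OF _ lim], rule always_eventually, rule allI)
    fix n
    have "norm (f n (T (x n))) \<le> norm (f n) * norm (T (x n))"
      by (rule norm_blinfun)
    also have "\<dots> \<le> M * norm (T (x n))"
      using M by (rule mult_right_mono) simp
    finally show "norm (f n (T (x n))) \<le> M * norm (T (x n))" .
  qed
qed

section \<open>Uniform convergence on order intervals of discrete lattices\<close>

lemma uniform_limit_interval_add: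
  fixes f :: "nat \<Rightarrow> 'a::banach_lattice \<Rightarrow>\<^sub>L real"
  assumes st: "0 \<le> s" "0 \<le> t"
    and s: "uniform_limit {0..s} (\<lambda>n. blinfun_apply (f n)) (\<lambda>_. 0) sequentially"
    and t: "uniform_limit {0..t} (\<lambda>n. blinfun_apply (f n)) (\<lambda>_. 0) sequentially"
  shows "uniform_limit {0..s + t} (\<lambda>n. blinfun_apply (f n)) (\<lambda>_. 0) sequentially"
proof (rule uniform_limitI)
  fix e :: real assume "e > 0"
  then have "e / 2 > 0" by simp
  from uniform_limitD[OF s this] uniform_limitD[OF t this]
  show "\<forall>\<^sub>F n in sequentially. \<forall>y\<in>{0..s + t}. dist (f n y) 0 < e"
  proof eventually_elim
    case (elim n)
    show ?case
    proof
      fix y assume "y \<in> {0..s + t}"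
      then have y: "inf y s \<in> {0..s}" "pprt (y - s) \<in> {0..t}" "y = inf y s + pprt (y - s)"
        using riesz_decomposition[of y s t] st by simp_all
      have "\<bar>f n (inf y s)\<bar> < e / 2" "\<bar>f n (pprt (y - s))\<bar> < e / 2"
        using elim y(1,2) by (simp_all add: dist_real_def)
      moreover have "f n y = f n (inf y s) + f n (pprt (y - s))"
        by (simp add: inf_add_pprt_diff flip: blinfun.add_right)
      ultimately show "dist (f n y) 0 < e"
        by (simp add: dist_real_def)
    qed
  qed
qed

text \<open>Every element of \<open>{0..a}\<close> is a multiple of \<open>a\<close> with a factor
  of absolute value at most \<open>1\<close>, so convergence at \<open>a\<close> suffices.\<close>

lemma uniform_limit_interval_atom:
  fixes f :: "nat \<Rightarrow> 'a::banach_lattice \<Rightarrow>\<^sub>L real"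
  assumes a: "atom a" and f: "(\<lambda>n. f n a) \<longlonglongrightarrow> 0"
  shows "uniform_limit {0..a} (\<lambda>n. blinfun_apply (f n)) (\<lambda>_. 0) sequentially"
proof (rule uniform_limitI)
  fix e :: real assume "e > 0"
  from tendstoD[OF f this]
  show "\<forall>\<^sub>F n in sequentially. \<forall>y\<in>{0..a}. dist (f n y) 0 < e"
  proof eventually_elim
    case (elim n)
    show ?case
    proof
      fix y assume y: "y \<in> {0..a}"
      then obtain c where c: "y = c *\<^sub>R a"
        using a by (auto simp: atom_def)
      have "norm y \<le> norm a"
        using y by (intro norm_mono_nonneg) simp_all
      moreover have "norm a > 0"
        using a by (auto simp: atom_def)
      ultimately have "\<bar>c\<bar> \<le> 1"
        by (simp add: c)
      then have "\<bar>c\<bar> * \<bar>f n a\<bar> \<le> 1 * \<bar>f n a\<bar>"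
        by (rule mult_right_mono) simp
      then have "\<bar>f n y\<bar> \<le> \<bar>f n a\<bar>"
        by (simp add: c blinfun.scaleR_right abs_mult)
      with elim show "dist (f n y) 0 < e"
        by (simp add: dist_real_def)
    qed
  qed
qed

text \<open>
  The elements \<open>s\<close> of \<open>{0..v}\<close> such that \<open>f\<close> tends to \<open>0\<close> uniformly on \<open>{0..s}\<close> are upward directed,
  and their supremum is \<open>v\<close>, since atoms can be added to them.
\<close>

lemma discrete_uniform_limit_interval:
  fixes f :: "nat \<Rightarrow> 'a::banach_lattice \<Rightarrow>\<^sub>L real"
  assumes disc: "discrete_lattice TYPE('a)" and ocn: "order_continuous_norm TYPE('a)"
    and f: "weakly_tendsto f 0" and v: "0 \<le> v"
  shows "uniform_limit {0..v} (\<lambda>n. blinfun_apply (f n)) (\<lambda>_. 0) sequentially"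
proof -
  define S where "S = {s. 0 \<le> s \<and> s \<le> v \<and>
    uniform_limit {0..s} (\<lambda>n. blinfun_apply (f n)) (\<lambda>_. 0) sequentially}"
  have S0: "0 \<in> S"
    using v by (simp add: S_def uniform_limit_iff)
  have Sadd: "s + t \<in> S" if "s \<in> S" "0 \<le> t" "s + t \<le> v"
    "uniform_limit {0..t} (\<lambda>n. blinfun_apply (f n)) (\<lambda>_. 0) sequentially" for s t
    using that unfolding S_def by (auto intro!: uniform_limit_interval_add)
  have Ssup: "sup s t \<in> S" if "s \<in> S" "t \<in> S" for s t
  proof -
    have "uniform_limit {0..s + t} (\<lambda>n. blinfun_apply (f n)) (\<lambda>_. 0) sequentially"
      using that by (intro uniform_limit_interval_add) (simp_all add: S_def)
    moreover have "sup s t \<le> s + t"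
      using that by (simp add: S_def)
    ultimately have "uniform_limit {0..sup s t} (\<lambda>n. blinfun_apply (f n)) (\<lambda>_. 0) sequentially"
      by (elim uniform_limit_on_subset) simp
    with that show ?thesis
      by (simp add: S_def le_supI1)
  qed
  \<comment> \<open>If \<open>y\<close> had a nonzero positive part, an atom \<open>a\<close> below
    it would satisfy \<open>a \<le> v - s\<close> for every \<open>s\<close> in \<open>S\<close>, so
    \<open>S\<close> would be closed under adding \<open>a\<close>. All multiples
    \<open>real n *\<^sub>R a\<close> would then lie below \<open>v\<close>, against the boundedness
    of their norms.\<close>
  have inf0: "y \<le> 0" if y: "\<forall>d\<in>(\<lambda>s. v - s) ` S. y \<le> d" for y
  proof (rule ccontr)
    assume "\<not> y \<le> 0"
    then have "pprt y \<noteq> 0"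
      using le_pprt[of y] by auto
    then have "0 < pprt y"
      using zero_le_pprt[of y] by (simp add: order.strict_iff_order)
    then obtain a where a: "atom a" "a \<le> pprt y"
      using disc unfolding discrete_lattice_def by blast
    have a0: "0 < a" using a(1) by (simp add: atom_def)
    have unif_a: "uniform_limit {0..a} (\<lambda>n. blinfun_apply (f n)) (\<lambda>_. 0) sequentially"
      by (rule uniform_limit_interval_atom[OF a(1) weakly_null_functionals_bounded(1)[OF f]])
    have step: "s + a \<in> S" if s: "s \<in> S" for s
    proof (rule Sadd[OF s _ _ unif_a])
      show "0 \<le> a" using a0 by simp
      have "y \<le> v - s" "0 \<le> v - s" using y s by (auto simp: S_def)
      then have "a \<le> v - s"
        using a(2) by (meson order_trans pprt_le_iff)
      then show "s + a \<le> v" by (simp add: le_diff_eq add.commute)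
    qed
    have multiples: "real n *\<^sub>R a \<in> S" for n
    proof (induction n)
      case (Suc n)
      then show ?case
        using step[OF Suc] by (simp add: scaleR_add_left add.commute)
    qed (simp add: S0)
    have "real n * norm a \<le> norm v" for n
    proof -
      have "norm (real n *\<^sub>R a) \<le> norm v"
        using multiples[of n] by (intro norm_mono_nonneg) (simp_all add: S_def)
      then show ?thesis by simp
    qed
    moreover have "norm a > 0" using a0 by auto
    ultimately show False
      using reals_Archimedean3[of "norm a"] by (meson not_le)
  qed
  obtain M where M: "M > 0" "\<And>n. norm (f n) \<le> M"
    using weakly_null_functionals_bounded(2)[OF f] by (auto simp: bounded_pos)
  show ?thesis
  proof (rule uniform_limitI)
    fix e :: real assume e: "e > 0"
    \<comment> \<open>Order continuity yields \<open>s\<close> in \<open>S\<close> close to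
      \<open>v\<close>. The part of \<open>y\<close> in \<open>{0..v - s}\<close> then contributes
      at most \<open>e / 2\<close>.\<close>
    have "\<exists>d\<in>(\<lambda>s. v - s) ` S. norm d < e / (2 * M)"
    proof (rule ocn[unfolded order_continuous_norm_def, rule_format])
      show "(\<lambda>s. v - s) ` S \<noteq> {} \<and>
        (\<forall>a\<in>(\<lambda>s. v - s) ` S. \<forall>b\<in>(\<lambda>s. v - s) ` S. \<exists>c\<in>(\<lambda>s. v - s) ` S. c \<le> a \<and> c \<le> b) \<and>
        (\<forall>d\<in>(\<lambda>s. v - s) ` S. 0 \<le> d) \<and> (\<forall>y. (\<forall>d\<in>(\<lambda>s. v - s) ` S. y \<le> d) \<longrightarrow> y \<le> 0)"
      proof (intro conjI ballI allI impI)
        show "(\<lambda>s. v - s) ` S \<noteq> {}" using S0 by auto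
        show "y \<le> 0" if "\<forall>d\<in>(\<lambda>s. v - s) ` S. y \<le> d" for y
          using that by (rule inf0)
        show "0 \<le> d" if "d \<in> (\<lambda>s. v - s) ` S" for d
          using that by (auto simp: S_def)
        fix a b assume "a \<in> (\<lambda>s. v - s) ` S" "b \<in> (\<lambda>s. v - s) ` S"
        then obtain s t where st: "s \<in> S" "t \<in> S" "a = v - s" "b = v - t" by auto
        have "v - sup s t \<le> a" "v - sup s t \<le> b"
          unfolding st(3,4) by (rule diff_left_mono, simp)+
        then show "\<exists>c\<in>(\<lambda>s. v - s) ` S. c \<le> a \<and> c \<le> b"
          using imageI[OF Ssup[OF st(1,2)], of "\<lambda>s. v - s"] by blast
      qed
      show "0 < e / (2 * M)" using e M(1) by simp
    qed
    then obtain s where s: "s \<in> S" "norm (v - s) < e / (2 * M)" by auto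
    have s0: "0 \<le> s" "0 \<le> v - s"
      and unif: "uniform_limit {0..s} (\<lambda>n. blinfun_apply (f n)) (\<lambda>_. 0) sequentially"
      using s(1) by (auto simp: S_def)
    have "e / 2 > 0" using e by simp
    from uniform_limitD[OF unif this]
    show "\<forall>\<^sub>F n in sequentially. \<forall>y\<in>{0..v}. dist (f n y) 0 < e"
    proof eventually_elim
      case (elim n)
      show ?case
      proof
        fix y assume "y \<in> {0..v}"
        then have y: "inf y s \<in> {0..s}" "pprt (y - s) \<in> {0..v - s}" "y = inf y s + pprt (y - s)"
          using riesz_decomposition[of y s "v - s"] s0 by simp_all
        have 1: "\<bar>f n (inf y s)\<bar> < e / 2"
          using elim y(1) by (simp add: dist_real_def)
        have "norm (pprt (y - s)) \<le> norm (v - s)"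
          using y(2) by (intro norm_mono_nonneg) simp_all
        then have "norm (f n) * norm (pprt (y - s)) \<le> M * (e / (2 * M))"
          using M s(2) by (intro mult_mono) simp_all
        then have 2: "\<bar>f n (pprt (y - s))\<bar> \<le> e / 2"
          using norm_blinfun[of "f n" "pprt (y - s)"] M(1) by simp
        have "f n y = f n (inf y s) + f n (pprt (y - s))"
          by (simp add: inf_add_pprt_diff flip: blinfun.add_right)
        then show "dist (f n y) 0 < e"
          using 1 2 by (simp add: dist_real_def)
      qed
    qed
  qed
qed


subsection \<open>AM-compactness\<close>

lemma continuous_map_weak_topologyI:
  assumes "\<And>g :: 'a::real_normed_vector \<Rightarrow>\<^sub>L real. continuous_map X euclideanreal (\<lambda>x. g (J x))"
  shows "continuous_map X weak_topology J"
  unfolding weak_topology_def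
proof (rule continuous_map_pullback')
  show "continuous_map X (product_topology (\<lambda>_. euclideanreal) UNIV)
      ((\<lambda>x (f :: 'a \<Rightarrow>\<^sub>L real). blinfun_apply f x) \<circ> J)"
    using assms by (simp add: continuous_map_componentwise_UNIV comp_def)
qed simp

lemma continuous_map_weak_topology_blinfun:
  fixes g :: "'a::real_normed_vector \<Rightarrow>\<^sub>L real"
  shows "continuous_map weak_topology (product_topology (\<lambda>_. euclideanreal) UNIV)
    (\<lambda>x (f :: 'a \<Rightarrow>\<^sub>L real). blinfun_apply f x)"
  using continuous_map_pullback[OF continuous_map_id] unfolding weak_topology_def by force

text \<open>Norming functionals separate points. The Hausdorff property is what makes weakly compact
  sets weakly closed.\<close>

lemma Hausdorff_weak_topology: "Hausdorff_space (weak_topology :: 'a::real_normed_vector topology)"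
proof (rule Hausdorff_space_injective_preimage)
  show "Hausdorff_space (product_topology (\<lambda>_ :: 'a \<Rightarrow>\<^sub>L real. euclideanreal) UNIV)"
    by (simp add: Hausdorff_space_product_topology)
  show "continuous_map weak_topology (product_topology (\<lambda>_. euclideanreal) UNIV)
    (\<lambda>x (f :: 'a \<Rightarrow>\<^sub>L real). blinfun_apply f x)"
    by (rule continuous_map_weak_topology_blinfun)
  show "inj_on (\<lambda>x (f :: 'a \<Rightarrow>\<^sub>L real). blinfun_apply f x) (topspace weak_topology)"
  proof (rule inj_onI)
    fix x y :: 'a
    assume eq: "(\<lambda>f :: 'a \<Rightarrow>\<^sub>L real. blinfun_apply f x) = (\<lambda>f. blinfun_apply f y)"
    obtain f :: "'a \<Rightarrow>\<^sub>L real" where f: "norm f \<le> 1" "f (x - y) = norm (x - y)"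
      by (rule norming_functional)
    have "f x = f y"
      using fun_cong[OF eq, of f] .
    with f(2) show "x = y" by (simp add: blinfun.diff_right)
  qed
qed

text \<open>The elements are plain functions, so that the product topology on functions restricts to
  the weak* topology.\<close>

definition dual_ball :: "real \<Rightarrow> ('a::real_normed_vector \<Rightarrow> real) set" where
  "dual_ball r = {\<phi>. linear \<phi> \<and> (\<forall>x. \<bar>\<phi> x\<bar> \<le> r * norm x)}"

lemma dual_ball_bounded_linear: "\<phi> \<in> dual_ball r \<Longrightarrow> bounded_linear \<phi>"
  by (intro bounded_linear_intro[of _ r])
    (auto simp: dual_ball_def linear_add linear_scale mult.commute)

text \<open>By Tychonoff a product of compact intervals is compact, and linearity is a closed
  condition on the coordinates.\<close>

lemma banach_alaoglu: "compact (dual_ball r :: ('a::real_normed_vector \<Rightarrow> real) set)"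
proof -
  have coord: "continuous_on UNIV (\<lambda>\<phi> :: 'a \<Rightarrow> real. \<phi> x)" for x
    by (rule continuous_on_product_coordinates)
  let ?P = "PiE UNIV (\<lambda>x :: 'a. {- (r * norm x)..r * norm x})"
  have "compactin (product_topology (\<lambda>_. euclideanreal) UNIV) ?P"
    by (simp add: compactin_PiE)
  then have "compact ?P"
    by (simp add: euclidean_product_topology)
  moreover have "closed {\<phi> :: 'a \<Rightarrow> real. linear \<phi>}"
  proof -
    have "{\<phi> :: 'a \<Rightarrow> real. linear \<phi>} =
        {\<phi>. \<forall>x y. \<phi> (x + y) = \<phi> x + \<phi> y} \<inter> {\<phi>. \<forall>c x. \<phi> (c *\<^sub>R x) = c * \<phi> x}"
      by (auto simp: linear_iff)
    then show ?thesis
      by (auto intro!: closed_Int closed_Collect_all closed_Collect_eq continuous_on_add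
          continuous_on_mult_left coord)
  qed
  ultimately have "compact (?P \<inter> {\<phi> :: 'a \<Rightarrow> real. linear \<phi>})"
    by (rule compact_Int_closed)
  moreover have "?P \<inter> {\<phi> :: 'a \<Rightarrow> real. linear \<phi>} = dual_ball r"
    by (auto simp: dual_ball_def PiE_UNIV_domain abs_le_iff minus_le_iff)
  ultimately show ?thesis by simp
qed

section \<open>Null sequences inside the bounded functions on a discrete space\<close>

lemma apply_Bcontfun_discrete:
  fixes F :: "'d discrete \<Rightarrow> 'b::metric_space"
  assumes "bounded (range F)"
  shows "apply_bcontfun (Bcontfun F) = F"
proof -
  have "continuous_on UNIV F"
    by (simp add: continuous_on_open_vimage open_discrete)
  with assms show ?thesis
    by (simp add: Bcontfun_inverse bcontfun_def)
qed

text \<open>For injective \<open>e\<close> the functions \<open>unit_fun (e n)\<close> are the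
  standard unit vectors of a copy of c_0.\<close>

definition unit_fun :: "'d discrete \<Rightarrow> ('d discrete \<Rightarrow>\<^sub>C real)" where
  "unit_fun a = Bcontfun (indicator {a})"

lemma apply_unit_fun: "apply_bcontfun (unit_fun a) d = indicator {a} d"
  unfolding unit_fun_def
  by (subst apply_Bcontfun_discrete) (auto intro!: boundedI[of _ 1] simp: indicator_def)

lemma apply_bcontfun_sum:
  "apply_bcontfun (sum F I) d = (\<Sum>i\<in>I. apply_bcontfun (F i) d)"
  for F :: "'i \<Rightarrow> ('a::topological_space \<Rightarrow>\<^sub>C 'b::real_normed_vector)"
  by (induction I rule: infinite_finite_induct) simp_all

lemma apply_sum_unit_fun:
  fixes e :: "nat \<Rightarrow> 'd discrete"
  assumes "inj e"
  shows "apply_bcontfun (\<Sum>n<N. c n *\<^sub>R unit_fun (e n)) (e k) = (if k < N then c k else 0)"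
    and "d \<notin> range e \<Longrightarrow> apply_bcontfun (\<Sum>n<N. c n *\<^sub>R unit_fun (e n)) d = 0"
proof -
  have "apply_bcontfun (\<Sum>n<N. c n *\<^sub>R unit_fun (e n)) (e k) = (\<Sum>n<N. if k = n then c n else 0)"
    using assms by (auto simp: apply_bcontfun_sum apply_unit_fun indicator_def inj_eq intro!: sum.cong)
  then show "apply_bcontfun (\<Sum>n<N. c n *\<^sub>R unit_fun (e n)) (e k) = (if k < N then c k else 0)"
    by simp
  show "apply_bcontfun (\<Sum>n<N. c n *\<^sub>R unit_fun (e n)) d = 0" if "d \<notin> range e"
    using that by (auto simp: apply_bcontfun_sum apply_unit_fun indicator_def intro!: sum.neutral)
qed

text \<open>The dual of c_0 is l^1: finite sums of unit vectors with signs have supremum norm at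
  most \<open>1\<close>.\<close>

lemma summable_functional_unit_fun:
  fixes g :: "('d discrete \<Rightarrow>\<^sub>C real) \<Rightarrow>\<^sub>L real"
  assumes e: "inj e"
  shows "summable (\<lambda>n. \<bar>g (unit_fun (e n))\<bar>)"
proof (rule summableI_nonneg_bounded)
  fix N :: nat
  define c where "c n = sgn (g (unit_fun (e n)))" for n
  let ?w = "\<Sum>n<N. c n *\<^sub>R unit_fun (e n)"
  have "norm ?w \<le> 1"
  proof (rule norm_bound)
    fix d
    show "norm (apply_bcontfun ?w d) \<le> 1"
      using apply_sum_unit_fun[OF e] by (cases "d \<in> range e") (auto simp: c_def sgn_if)
  qed
  have "\<bar>g (unit_fun (e n))\<bar> = c n * g (unit_fun (e n))" for n
    by (simp add: c_def sgn_if)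
  then have "(\<Sum>n<N. \<bar>g (unit_fun (e n))\<bar>) = g ?w"
    by (simp add: blinfun.sum_right blinfun.scaleR_right)
  also have "\<dots> \<le> norm g * norm ?w"
    using norm_blinfun[of g ?w] by simp
  also have "\<dots> \<le> norm g * 1"
    using \<open>norm ?w \<le> 1\<close> by (rule mult_left_mono) simp
  finally show "(\<Sum>n<N. \<bar>g (unit_fun (e n))\<bar>) \<le> norm g" by simp
qed (rule abs_ge_zero)

text \<open>The \<open>N\<close>-th partial sum differs from \<open>F\<close> only at the points
  \<open>e k\<close> with \<open>k \<ge> N\<close>, where the error is the absolute value of
  \<open>c k\<close>.\<close>

lemma null_sequence_expansion:
  fixes F :: "'d discrete \<Rightarrow>\<^sub>C real"
  assumes e: "inj e" and F: "\<And>n. F (e n) = c n" "\<And>d. d \<notin> range e \<Longrightarrow> F d = 0"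
    and c: "c \<longlonglongrightarrow> 0"
  shows "(\<lambda>N. \<Sum>n<N. c n *\<^sub>R unit_fun (e n)) \<longlonglongrightarrow> F"
proof (rule LIM_zero_cancel, rule tendsto_norm_zero_cancel)
  show "(\<lambda>N. norm ((\<Sum>n<N. c n *\<^sub>R unit_fun (e n)) - F)) \<longlonglongrightarrow> 0"
  proof (rule tendstoI)
    fix r :: real assume "r > 0"
    then have "r / 2 > 0" by simp
    from tendstoD[OF c this] obtain N0 where N0: "\<And>n. n \<ge> N0 \<Longrightarrow> \<bar>c n\<bar> < r / 2"
      by (auto simp: eventually_sequentially dist_real_def)
    have "norm ((\<Sum>n<N. c n *\<^sub>R unit_fun (e n)) - F) \<le> r / 2" if N: "N \<ge> N0" for N
    proof (rule norm_bound)
      fix d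
      show "norm (apply_bcontfun ((\<Sum>n<N. c n *\<^sub>R unit_fun (e n)) - F) d) \<le> r / 2"
      proof (cases "d \<in> range e")
        case True
        then obtain k where "d = e k" by auto
        then show ?thesis
          using N0[of k] N \<open>r / 2 > 0\<close> apply_sum_unit_fun(1)[OF e, of c N k]
          by (auto simp: F(1) not_less)
      next
        case False
        then show ?thesis
          using \<open>r / 2 > 0\<close> apply_sum_unit_fun(2)[OF e False, of c N] by (simp add: F(2))
      qed
    qed
    then have "norm ((\<Sum>n<N. c n *\<^sub>R unit_fun (e n)) - F) < r" if "N \<ge> N0" for N
      using that \<open>r > 0\<close> by fastforce
    then show "\<forall>\<^sub>F N in sequentially. dist (norm ((\<Sum>n<N. c n *\<^sub>R unit_fun (e n)) - F)) 0 < r"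
      by (intro eventually_sequentiallyI[of N0]) simp
  qed
qed

text \<open>
  For a weakly null sequence \<open>f\<close> in the dual of \<open>'a\<close> let \<open>S x\<close> be the sequence \<open>f n x\<close>, placed at the
  positions \<open>e n\<close>. The map \<open>J\<close> below is the second adjoint of \<open>S\<close>. Its values are null sequences, so
  that it is continuous from the weak* to the weak topology, and \<open>S\<close> maps balls into the
  weakly compact images under \<open>J\<close> of balls in the bidual.
\<close>

lemma weakly_compact_op_of_weakly_null:
  fixes f :: "nat \<Rightarrow> 'a::banach \<Rightarrow>\<^sub>L real" and e :: "nat \<Rightarrow> 'd discrete"
  assumes f: "weakly_tendsto f 0" and e: "inj e"
  shows "\<exists>S :: 'a \<Rightarrow>\<^sub>L ('d discrete \<Rightarrow>\<^sub>C real). weakly_compact_op S \<and> (\<forall>x n. apply_bcontfun (S x) (e n) = f n x)"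
proof -
  obtain M where M: "M > 0" "\<And>n. norm (f n) \<le> M"
    using weakly_null_functionals_bounded(2)[OF f] by (auto simp: bounded_pos)
  \<comment> \<open>Outside the range of \<open>e\<close> the value is \<open>0\<close>, so that
    \<open>J \<phi>\<close> vanishes there for linear \<open>\<phi>\<close>.\<close>
  define h where "h d = (if d \<in> range e then f (inv e d) else 0)" for d
  have h_e: "h (e n) = f n" and h_out: "d \<notin> range e \<Longrightarrow> h d = 0" for n d
    using e by (simp_all add: h_def)
  have h_norm: "norm (h d) \<le> M" for d
    using M by (simp add: h_def)
  define J where "J \<phi> = Bcontfun (\<lambda>d. \<phi> (h d))" for \<phi> :: "('a \<Rightarrow>\<^sub>L real) \<Rightarrow> real"
  have J: "apply_bcontfun (J \<phi>) d = \<phi> (h d)" if \<phi>: "\<phi> \<in> dual_ball r" for \<phi> r d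
  proof -
    have "\<bar>\<phi> (h d)\<bar> \<le> \<bar>r\<bar> * M" for d
    proof -
      have "\<bar>\<phi> (h d)\<bar> \<le> r * norm (h d)"
        using \<phi> by (simp add: dual_ball_def)
      also have "\<dots> \<le> \<bar>r\<bar> * M"
        using h_norm by (intro mult_mono) simp_all
      finally show ?thesis .
    qed
    then show ?thesis
      unfolding J_def by (subst apply_Bcontfun_discrete) (auto intro!: boundedI[of _ "\<bar>r\<bar> * M"])
  qed
  have eval: "(\<lambda>g. blinfun_apply g x) \<in> dual_ball r" if "norm x \<le> r" for x :: 'a and r
  proof -
    have "\<bar>blinfun_apply g x\<bar> \<le> r * norm g" for g :: "'a \<Rightarrow>\<^sub>L real"
      using norm_blinfun[of g x] mult_left_mono[OF that, of "norm g"] by (simp add: mult.commute)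
    then show ?thesis
      by (auto simp: dual_ball_def linear_iff blinfun.add_left blinfun.scaleR_left)
  qed
  define S where "S = Blinfun (\<lambda>x. J (\<lambda>g. blinfun_apply g x))"
  have Jx: "apply_bcontfun (J (\<lambda>g. blinfun_apply g x)) d = h d x" for x d
    by (rule J[OF eval[OF order_refl]])
  have "bounded_linear (\<lambda>x. J (\<lambda>g. blinfun_apply g x))"
  proof (rule bounded_linear_intro[of _ M])
    fix x y and c :: real
    show "J (\<lambda>g. blinfun_apply g (x + y)) = J (\<lambda>g. blinfun_apply g x) + J (\<lambda>g. blinfun_apply g y)"
      by (rule bcontfun_eqI) (simp add: Jx, simp add: blinfun.add_right)
    show "J (\<lambda>g. blinfun_apply g (c *\<^sub>R x)) = c *\<^sub>R J (\<lambda>g. blinfun_apply g x)"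
      by (rule bcontfun_eqI) (simp add: Jx, simp add: blinfun.scaleR_right)
    show "norm (J (\<lambda>g. blinfun_apply g x)) \<le> norm x * M"
    proof (rule norm_bound)
      fix d
      show "norm (apply_bcontfun (J (\<lambda>g. blinfun_apply g x)) d) \<le> norm x * M"
        using norm_blinfun[of "h d" x] mult_right_mono[OF h_norm[of d], of "norm x"]
        by (simp add: Jx mult.commute)
    qed
  qed
  then have S: "blinfun_apply S x = J (\<lambda>g. blinfun_apply g x)" for x
    unfolding S_def by (simp add: bounded_linear_Blinfun_apply)
  \<comment> \<open>On a ball of the bidual, \<open>g\<close> after \<open>J\<close> is evaluation
    at one element \<open>H\<close> of the dual, the sum of the \<open>f n\<close> with the
    absolutely summable coefficients \<open>g (unit_fun (e n))\<close>. This is the weak* continuity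
    of \<open>J\<close>.\<close>
  have weak_star: "\<exists>H. \<forall>\<phi>\<in>dual_ball r. g (J \<phi>) = \<phi> H" for g :: "('d discrete \<Rightarrow>\<^sub>C real) \<Rightarrow>\<^sub>L real" and r
  proof -
    have "summable (\<lambda>n. g (unit_fun (e n)) *\<^sub>R f n)"
    proof (rule summable_comparison_test')
      show "summable (\<lambda>n. \<bar>g (unit_fun (e n))\<bar> * M)"
        by (rule summable_mult2[OF summable_functional_unit_fun[OF e]])
      show "norm (g (unit_fun (e n)) *\<^sub>R f n) \<le> \<bar>g (unit_fun (e n))\<bar> * M" if "n \<ge> 0" for n
        using M(2)[of n] by (simp add: mult_left_mono)
    qed
    then obtain H where H: "(\<lambda>N. \<Sum>n<N. g (unit_fun (e n)) *\<^sub>R f n) \<longlonglongrightarrow> H"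
      using summable_LIMSEQ by blast
    have "g (J \<phi>) = \<phi> H" if \<phi>: "\<phi> \<in> dual_ball r" for \<phi>
    proof -
      have bl: "bounded_linear \<phi>" using \<phi> by (rule dual_ball_bounded_linear)
      have lin: "linear \<phi>" using bl by (rule bounded_linear.linear)
      \<comment> \<open>Weak convergence of \<open>f\<close>, tested against the bidual element
        \<open>\<phi>\<close>, is what makes \<open>J \<phi>\<close> a null sequence and allows its
        expansion in unit vectors.\<close>
      have "(\<lambda>n. blinfun_apply (Blinfun \<phi>) (f n)) \<longlonglongrightarrow> blinfun_apply (Blinfun \<phi>) 0"
        using f unfolding weakly_tendsto_def by blast
      then have "(\<lambda>n. \<phi> (f n)) \<longlonglongrightarrow> 0"
        by (simp add: bounded_linear_Blinfun_apply[OF bl] linear_0[OF lin])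
      then have "(\<lambda>N. \<Sum>n<N. \<phi> (f n) *\<^sub>R unit_fun (e n)) \<longlonglongrightarrow> J \<phi>"
        by (intro null_sequence_expansion[OF e])
          (simp_all add: J[OF \<phi>] h_e h_out linear_0[OF lin])
      then have lim: "(\<lambda>N. g (\<Sum>n<N. \<phi> (f n) *\<^sub>R unit_fun (e n))) \<longlonglongrightarrow> g (J \<phi>)"
        by (rule blinfun.tendsto[OF tendsto_const])
      have "(\<lambda>N. \<phi> (\<Sum>n<N. g (unit_fun (e n)) *\<^sub>R f n)) \<longlonglongrightarrow> \<phi> H"
        by (rule bounded_linear.tendsto[OF bl H])
      moreover have "\<phi> (\<Sum>n<N. g (unit_fun (e n)) *\<^sub>R f n) = g (\<Sum>n<N. \<phi> (f n) *\<^sub>R unit_fun (e n))" for N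
        unfolding blinfun.sum_right blinfun.scaleR_right linear_sum[OF lin] linear_scale[OF lin]
        by (simp add: mult.commute)
      ultimately have "(\<lambda>N. g (\<Sum>n<N. \<phi> (f n) *\<^sub>R unit_fun (e n))) \<longlonglongrightarrow> \<phi> H"
        by (simp only:)
      with lim show ?thesis by (rule LIMSEQ_unique)
    qed
    then show ?thesis by blast
  qed
  have compact: "compactin weak_topology (J ` dual_ball r)" for r
  proof (rule image_compactin)
    show "compactin (top_of_set (dual_ball r)) (dual_ball r)"
      using banach_alaoglu by (simp add: compactin_subtopology)
    show "continuous_map (top_of_set (dual_ball r)) weak_topology J"
    proof (rule continuous_map_weak_topologyI)
      fix g :: "('d discrete \<Rightarrow>\<^sub>C real) \<Rightarrow>\<^sub>L real"
      obtain H where H: "\<forall>\<phi>\<in>dual_ball r. g (J \<phi>) = \<phi> H"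
        using weak_star by blast
      have "continuous_on (dual_ball r) (\<lambda>\<phi> :: ('a \<Rightarrow>\<^sub>L real) \<Rightarrow> real. \<phi> H)"
        by (rule continuous_on_subset[OF continuous_on_product_coordinates]) simp
      then have "continuous_on (dual_ball r) (\<lambda>\<phi>. g (J \<phi>))"
        by (rule continuous_on_eq) (simp add: H)
      then show "continuous_map (top_of_set (dual_ball r)) euclideanreal (\<lambda>\<phi>. g (J \<phi>))"
        by simp
    qed
  qed
  have "weakly_compact_op S"
    unfolding weakly_compact_op_def
  proof (intro allI impI)
    fix B :: "'a set" assume "bounded B"
    then obtain r where r: "\<And>x. x \<in> B \<Longrightarrow> norm x \<le> r"
      by (auto simp: bounded_iff)
    have "blinfun_apply S ` B \<subseteq> J ` dual_ball r"
      unfolding S by (intro image_subsetI imageI eval r)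
    moreover have "closedin weak_topology (J ` dual_ball r)"
      by (rule compactin_imp_closedin[OF Hausdorff_weak_topology compact])
    ultimately show "compactin weak_topology (weak_topology closure_of (blinfun_apply S ` B))"
      by (intro closed_compactin[OF compact] closure_of_minimal closedin_closure_of)
  qed
  moreover have "apply_bcontfun (S x) (e n) = f n x" for x n
    by (simp add: S Jx h_e)
  ultimately show ?thesis by blast
qed

text \<open>The image of \<open>{0..v}\<close> under \<open>S\<close> has compact closure, so
  finitely many points of the interval control \<open>f n\<close> on all of it, uniformly in
  \<open>n\<close>.\<close>

lemma am_compactness_uniform_limit_interval:
  fixes f :: "nat \<Rightarrow> 'a::banach_lattice \<Rightarrow>\<^sub>L real"
  assumes am: "am_compactness_property TYPE('a)" and f: "weakly_tendsto f 0" and v: "0 \<le> v"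
  shows "uniform_limit {0..v} (\<lambda>n. blinfun_apply (f n)) (\<lambda>_. 0) sequentially"
proof (cases "v = 0")
  case True
  then show ?thesis by (simp add: uniform_limit_iff)
next
  case False
  \<comment> \<open>The multiples of the nonzero \<open>v\<close> supply infinitely many distinct
    positions in the index set \<open>'a discrete\<close>.\<close>
  define e where "e n = discrete (real n *\<^sub>R v)" for n
  have "inj e"
    using False by (auto simp: inj_def e_def discrete_inject)
  then obtain S :: "'a \<Rightarrow>\<^sub>L ('a discrete \<Rightarrow>\<^sub>C real)"
    where S: "weakly_compact_op S" "\<And>x n. apply_bcontfun (S x) (e n) = f n x"
    using weakly_compact_op_of_weakly_null[OF f] by blast
  then have "am_compact_op S"
    using am by (simp add: am_compactness_property_def am_compactness_wrt_def)
  then have compact: "compact (closure (S ` {0..v}))"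
    unfolding am_compact_op_def by blast
  show ?thesis
  proof (rule uniform_limitI)
    fix r :: real assume r: "r > 0"
    have cover: "closure (S ` {0..v}) \<subseteq> (\<Union>y\<in>{0..v}. ball (S y) (r / 2))"
    proof
      fix z assume "z \<in> closure (S ` {0..v})"
      moreover have "r / 2 > 0" using r by simp
      ultimately have "\<exists>w\<in>S ` {0..v}. dist w z < r / 2"
        unfolding closure_approachable by blast
      then show "z \<in> (\<Union>y\<in>{0..v}. ball (S y) (r / 2))" by auto
    qed
    obtain C where C: "C \<subseteq> {0..v}" "finite C"
      "closure (S ` {0..v}) \<subseteq> (\<Union>y\<in>C. ball (S y) (r / 2))"
      by (rule compactE_image[OF compact open_ball cover]) (rule that)
    have "\<forall>\<^sub>F n in sequentially. dist (f n y) 0 < r / 2" for y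
      using r by (intro tendstoD weakly_null_functionals_bounded(1)[OF f]) simp
    then have "\<forall>\<^sub>F n in sequentially. \<forall>y\<in>C. dist (f n y) 0 < r / 2"
      by (simp add: eventually_ball_finite_distrib C(2))
    then show "\<forall>\<^sub>F n in sequentially. \<forall>y\<in>{0..v}. dist (f n y) 0 < r"
    proof eventually_elim
      case (elim n)
      show ?case
      proof
        fix y assume "y \<in> {0..v}"
        then have "S y \<in> closure (S ` {0..v})"
          by (intro subsetD[OF closure_subset] imageI)
        then have "S y \<in> (\<Union>y\<in>C. ball (S y) (r / 2))"
          by (rule subsetD[OF C(3)])
        then obtain z where z: "z \<in> C" "dist (S z) (S y) < r / 2"
          unfolding UN_iff mem_ball by (elim bexE)
        \<comment> \<open>\<open>f n\<close> is the coordinate of \<open>S\<close> at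
          \<open>e n\<close>, and the supremum distance bounds every coordinate.\<close>
        have "dist (f n z) (f n y) \<le> dist (S z) (S y)"
          using dist_bounded[of "S z" "e n" "S y"] by (simp add: S(2))
        moreover have "dist (f n z) 0 < r / 2"
          using elim z(1) by blast
        ultimately show "dist (f n y) 0 < r"
          using z(2) unfolding dist_real_def by linarith
      qed
    qed
  qed
qed


theorem theorem4p4:
  fixes T :: "'e::banach_lattice \<Rightarrow>\<^sub>L 'f::banach_lattice"
  assumes "positive_op T"
    and "uaw_dunford_pettis T"
    and "weakly_seq_cont_lattice_ops TYPE('e)
         \<or> (discrete_lattice TYPE('f) \<and> order_continuous_norm TYPE('f))
         \<or> am_compactness_property TYPE('f)"
  shows "weak_dunford_pettis T"
  using assms(3)
proof (elim disjE conjE)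
  assume "weakly_seq_cont_lattice_ops TYPE('e)"
  then show ?thesis
    by (rule weak_dunford_pettis_if_weakly_seq_cont[OF assms(2)])
next
  assume "discrete_lattice TYPE('f)" "order_continuous_norm TYPE('f)"
  then show ?thesis
    by (rule weak_dunford_pettis_if_uniform_limit[OF assms(1,2) discrete_uniform_limit_interval])
next
  assume "am_compactness_property TYPE('f)"
  then show ?thesis
    by (rule weak_dunford_pettis_if_uniform_limit[OF assms(1,2) am_compactness_uniform_limit_interval])
qed

end
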